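(* Let $D$ be a $\mathsf{Le}$-diagram (fitting inside a $2\times(n-2)$ box) of a loopless rank $2$ positroid on $[n]$. The positroid associated with $D$ is transversal if and only if $\tau_D\le 2$. Moreover, when the positroid is transversal it has a noncrossing minimal presentation.
   Context: $[n]=\{1,\dots,n\}$. **Diagrams.** Young diagrams are left-justified with the largest part on top; box $(i,j)$ is in row $i$ (increasing downward) and column $j$ (increasing to the right). A $\mathsf{Le}$-diagram is a filling of a Young diagram in which each box is either empty or contains $\bullet$, such that for $i<i'$ and $j<j'$: if box $(i',j')$ exists and boxes $(i,j')$ and $(i',j)$ both contain $\bullet$, then $(i',j')$ contains $\bullet$. Here diagrams fit inside a $2\times(n-2)$ box; the top row is row $1$ and the bottom row is row $2$. **Positroid associated with $D$.** The southeast border of $D$ inside the $2\times(n-2)$ box (together, where needed, with parts of the top and left sides of the box) is a lattice path from the top right corner to the bottom left corner of the box. Place a boundary vertex on each of its $n$ steps, labeled $1,\dots,n$ in order starting from the top right. Vertical steps are sources (one for each row), horizontal steps are sinks (one for each column). Each $\bullet$ is an internal vertex. From each source or internal vertex, a directed edge is drawn leftward to the nearest internal vertex to the left in the same row, if there is one; it carries a positive real weight. From each internal vertex a directed edge of weight $1$ is drawn downward to the nearest internal vertex below it in the same column, or to the sink of that column if there is none. Call this network $N_D$. With $K$ the set of sources, $\operatorname{Meas}(N_D)$ is the $K\times[n]$ matrix with entries $\operatorname{Meas}(N_D)_{ij}=\sum_{P:i\rightsquigarrow j}(-1)^{s_{ij}}\prod_{e\in P}w_e$, the sum being over directed paths from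 $i$ to $j$ (the empty path gives $\operatorname{Meas}(N_D)_{ii}=1$), where $w_e$ is the weight of $e$ and $s_{ij}$ is the number of sources strictly between $i$ and $j$. The positroid associated with $D$ is the matroid on $[n]$ whose bases are the $2$-subsets indexing nonvanishing maximal minors of $\operatorname{Meas}(N_D)$; it does not depend on the choice of positive weights. It is loopless exactly when each of the $n-2$ columns of the box contains at least one $\bullet$ of $D$. **The integer $\tau_D$.** For $i\ge1$, $\mathcal{L}(i)$ denotes the two-row diagram with $i+1$ columns in which every bottom-row box contains $\bullet$, the rightmost top-row box contains $\bullet$, and all other top-row boxes are empty (so exactly $i$ columns contain a single $\bullet$). A contiguous subdiagram of $D$ is a diagram obtained by taking consecutive columns of $D$. An $\mathcal{L}(i)$ occurring as a contiguous subdiagram of $D$ is maximal if it cannot be extended to the left to make an $\mathcal{L}(i+1)$. The integer $\tau_D$ is defined as follows. (1) Start with the number of distinct maximal contiguous subdiagrams $\mathcal{L}(i)$ of $D$, over all $i\ge1$. (2) Ignoring any columns covered by (1): (a) if there is a column with a $\bullet$ only in the top row, add $1$; and (b) if there is a column with a $\bullet$ only in the bottom row that is to the right of every column with $\bullet$'s in both rows, add $1$. **Transversal matroids.** A set system $(S_1,\dots,S_k)$ is a family of subsets of $E$, repetitions allowed, considered up to reordering. A transversal is a set $I\subseteq E$ with a bijection $\phi:[k]\to I$ such that $\phi(j)\in S_j$ for all $j$. All set systems are assumed to have a transversal. $M[(S_1,\dots,S_k)]$ is the matroid whose bases are the transversals; such a matroid is called transversal and $(S_1,\dots,S_k)$ is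 a presentation of it (presentations of rank $k$ matroids always use exactly $k$ sets). A presentation $(S_1,\dots,S_k)$ is minimal if whenever $(S'_1,\dots,S'_k)$ is a presentation of the same matroid with, after some reordering, $S'_i\subseteq S_i$ for all $i$, then the two set systems are equal. **Noncrossing.** For $a\in[n]$, let $<_a$ be the total order $a<_a a+1<_a\cdots<_a n<_a 1<_a\cdots<_a a-1$. For $S,T\subseteq[n]$, $S$ crosses $T$ if there are $a,b,c,d\in[n]$ with $a<_a b<_a c<_a d$, $a,c\in S$, $a,c\notin T$, $b,d\in T$, and $b\notin S$. A set system is crossing if $S_i$ crosses $S_j$ for some $i,j$, and noncrossing otherwise. *)

theory Defs
  imports
    "HOL-Library.Multiset"
    "Graph_Theory.Arc_Walk"
    "Jordan_Normal_Form.Determinant"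
begin

section \<open>Le-diagrams\<close>

text \<open>Box \<open>(i, j)\<close> is in row \<open>i\<close> (counted downward from 1) and column \<open>j\<close> (counted
  rightward from 1).  The field \<open>boxes\<close> is the Young diagram, \<open>bullets\<close> the set of boxes
  that contain a bullet.\<close>

record filled_diagram =
  boxes :: "(nat \<times> nat) set"
  bullets :: "(nat \<times> nat) set"

definition young_in_box :: "nat \<Rightarrow> nat \<Rightarrow> (nat \<times> nat) set \<Rightarrow> bool" where
  "young_in_box k m Y \<longleftrightarrow> Y \<subseteq> {1..k} \<times> {1..m} \<and>
     (\<forall>i j i' j'. (i, j) \<in> Y \<and> 1 \<le> i' \<and> i' \<le> i \<and> 1 \<le> j' \<and> j' \<le> j \<longrightarrow> (i', j') \<in> Y)"

definition le_diagram :: "nat \<Rightarrow> nat \<Rightarrow> filled_diagram \<Rightarrow> bool" where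
  "le_diagram k m D \<longleftrightarrow> young_in_box k m (boxes D) \<and> bullets D \<subseteq> boxes D \<and>
     (\<forall>i i' j j'. i < i' \<and> j < j' \<and> (i', j') \<in> boxes D \<and>
        (i, j') \<in> bullets D \<and> (i', j) \<in> bullets D \<longrightarrow> (i', j') \<in> bullets D)"


section \<open>The network and the positroid of a diagram in a \<open>k \<times> (n - k)\<close> box\<close>

text \<open>The border path runs from the top right to the bottom left corner of the box; a step's
  label is one more than the number of steps before it.  The vertical step of row \<open>r\<close> comes
  after \<open>r - 1\<close> vertical steps and after the horizontal steps of the columns not meeting
  row \<open>r\<close>; the horizontal step of column \<open>c\<close> comes after those of the columns further right
  and after the vertical steps of the rows meeting column \<open>c\<close>.\<close>

definition source_label :: "nat \<Rightarrow> nat \<Rightarrow> filled_diagram \<Rightarrow> nat \<Rightarrow> nat" where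
  "source_label k n D r = (n - k - card {c. (r, c) \<in> boxes D}) + (r - 1) + 1"

definition sink_label :: "nat \<Rightarrow> nat \<Rightarrow> filled_diagram \<Rightarrow> nat \<Rightarrow> nat" where
  "sink_label k n D c = (n - k - c) + card {r. (r, c) \<in> boxes D} + 1"

definition sources :: "nat \<Rightarrow> nat \<Rightarrow> filled_diagram \<Rightarrow> nat set" where
  "sources k n D = source_label k n D ` {1..k}"

datatype vertex = Boundary nat | Internal nat nat

definition horizontal_arcs :: "nat \<Rightarrow> nat \<Rightarrow> filled_diagram \<Rightarrow> (vertex \<times> vertex) set" where
  "horizontal_arcs k n D =
     {(Boundary (source_label k n D r), Internal r c') | r c'.
        r \<in> {1..k} \<and> (r, c') \<in> bullets D \<and> (\<forall>x. c' < x \<longrightarrow> (r, x) \<notin> bullets D)} \<union>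
     {(Internal r c, Internal r c') | r c c'.
        (r, c) \<in> bullets D \<and> (r, c') \<in> bullets D \<and> c' < c \<and>
        (\<forall>x. c' < x \<and> x < c \<longrightarrow> (r, x) \<notin> bullets D)}"

definition vertical_arcs :: "nat \<Rightarrow> nat \<Rightarrow> filled_diagram \<Rightarrow> (vertex \<times> vertex) set" where
  "vertical_arcs k n D =
     {(Internal r c, Internal r' c) | r r' c.
        (r, c) \<in> bullets D \<and> (r', c) \<in> bullets D \<and> r < r' \<and>
        (\<forall>x. r < x \<and> x < r' \<longrightarrow> (x, c) \<notin> bullets D)} \<union>
     {(Internal r c, Boundary (sink_label k n D c)) | r c.
        (r, c) \<in> bullets D \<and> (\<forall>x. r < x \<longrightarrow> (x, c) \<notin> bullets D)}"

definition network :: "nat \<Rightarrow> nat \<Rightarrow> filled_diagram \<Rightarrow> (vertex, vertex \<times> vertex) pre_digraph" where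
  "network k n D =
     \<lparr>verts = Boundary ` {1..n} \<union> (\<lambda>(r, c). Internal r c) ` bullets D,
      arcs = horizontal_arcs k n D \<union> vertical_arcs k n D,
      tail = fst, head = snd\<rparr>"

definition network_weights ::
    "nat \<Rightarrow> nat \<Rightarrow> filled_diagram \<Rightarrow> (vertex \<times> vertex \<Rightarrow> real) \<Rightarrow> bool" where
  "network_weights k n D w \<longleftrightarrow>
     (\<forall>e \<in> horizontal_arcs k n D. 0 < w e) \<and> (\<forall>e \<in> vertical_arcs k n D. w e = 1)"

definition meas ::
    "nat \<Rightarrow> nat \<Rightarrow> filled_diagram \<Rightarrow> (vertex \<times> vertex \<Rightarrow> real) \<Rightarrow> nat \<Rightarrow> nat \<Rightarrow> real" where
  "meas k n D w i j =
     (\<Sum>p | pre_digraph.apath (network k n D) (Boundary i) p (Boundary j).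
        (- 1) ^ card {s \<in> sources k n D. min i j < s \<and> s < max i j} * prod_list (map w p))"

definition maximal_minor ::
    "nat \<Rightarrow> nat \<Rightarrow> filled_diagram \<Rightarrow> (vertex \<times> vertex \<Rightarrow> real) \<Rightarrow> nat set \<Rightarrow> real" where
  "maximal_minor k n D w J =
     det (mat k k (\<lambda>(a, b). meas k n D w (sorted_list_of_set (sources k n D) ! a)
                                         (sorted_list_of_set J ! b)))"

text \<open>A matroid on a ground set is represented by its set of bases.\<close>

definition positroid_bases ::
    "nat \<Rightarrow> nat \<Rightarrow> filled_diagram \<Rightarrow> (vertex \<times> vertex \<Rightarrow> real) \<Rightarrow> nat set set" where
  "positroid_bases k n D w = {J. J \<subseteq> {1..n} \<and> card J = k \<and> maximal_minor k n D w J \<noteq> 0}"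

definition loopless :: "'a set \<Rightarrow> 'a set set \<Rightarrow> bool" where
  "loopless E \<B> \<longleftrightarrow> (\<forall>e \<in> E. \<exists>B \<in> \<B>. e \<in> B)"


section \<open>The integer \<open>\<tau>\<close> of a two-row diagram\<close>

definition L_diagram :: "nat \<Rightarrow> filled_diagram" where
  "L_diagram i =
     \<lparr>boxes = {1, 2} \<times> {1..i + 1},
      bullets = {2} \<times> {1..i + 1} \<union> {(1, i + 1)}\<rparr>"

text \<open>The contiguous subdiagram formed by the \<open>m\<close> columns \<open>s + 1, \<dots>, s + m\<close>, renumbered
  from 1.\<close>

definition subdiagram :: "filled_diagram \<Rightarrow> nat \<Rightarrow> nat \<Rightarrow> filled_diagram" where
  "subdiagram D s m =
     \<lparr>boxes = {(r, c). c \<in> {1..m} \<and> (r, s + c) \<in> boxes D},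
      bullets = {(r, c). c \<in> {1..m} \<and> (r, s + c) \<in> bullets D}\<rparr>"

definition maximal_Ls :: "filled_diagram \<Rightarrow> (nat \<times> nat) set" where
  "maximal_Ls D = {(s, i). 1 \<le> i \<and> subdiagram D s (i + 1) = L_diagram i \<and>
     \<not> (\<exists>s'. s = s' + 1 \<and> subdiagram D s' (i + 2) = L_diagram (i + 1))}"

definition covered_columns :: "filled_diagram \<Rightarrow> nat set" where
  "covered_columns D = (\<Union>(s, i) \<in> maximal_Ls D. {s + 1..s + (i + 1)})"

definition only_top :: "filled_diagram \<Rightarrow> nat \<Rightarrow> bool" where
  "only_top D c \<longleftrightarrow> (1, c) \<in> bullets D \<and> (2, c) \<notin> bullets D"

definition only_bottom :: "filled_diagram \<Rightarrow> nat \<Rightarrow> bool" where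
  "only_bottom D c \<longleftrightarrow> (1, c) \<notin> bullets D \<and> (2, c) \<in> bullets D"

definition both_rows :: "filled_diagram \<Rightarrow> nat \<Rightarrow> bool" where
  "both_rows D c \<longleftrightarrow> (1, c) \<in> bullets D \<and> (2, c) \<in> bullets D"

text \<open>The columns covered by maximal \<open>L(i)\<close> are ignored throughout the last two summands, also
  when an only-bottom column is compared with the columns having bullets in both rows.
  \<open>maximal_Ls\<close> counts occurrences by position: a pair \<open>(s, i)\<close> is an \<open>L(i)\<close> in the columns
  \<open>s + 1, \<dots>, s + i + 1\<close>.\<close>

definition tau :: "filled_diagram \<Rightarrow> nat" where
  "tau D = card (maximal_Ls D)
     + (if \<exists>c. c \<notin> covered_columns D \<and> only_top D c then 1 else 0)
     + (if \<exists>c. c \<notin> covered_columns D \<and> only_bottom D c \<and>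
             (\<forall>c'. c' \<notin> covered_columns D \<and> both_rows D c' \<longrightarrow> c' < c) then 1 else 0)"


section \<open>Transversal matroids\<close>

text \<open>A set system is a list of sets; notions that disregard the order of the list compare
  lists through \<^const>\<open>mset\<close>.\<close>

definition is_transversal :: "'a set \<Rightarrow> 'a set list \<Rightarrow> 'a set \<Rightarrow> bool" where
  "is_transversal E Ss I \<longleftrightarrow> I \<subseteq> E \<and>
     (\<exists>\<phi>. bij_betw \<phi> {..<length Ss} I \<and> (\<forall>j < length Ss. \<phi> j \<in> Ss ! j))"

definition set_system :: "'a set \<Rightarrow> 'a set list \<Rightarrow> bool" where
  "set_system E Ss \<longleftrightarrow> (\<forall>S \<in> set Ss. S \<subseteq> E) \<and> (\<exists>I. is_transversal E Ss I)"

definition presentation :: "'a set \<Rightarrow> 'a set set \<Rightarrow> 'a set list \<Rightarrow> bool" where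
  "presentation E \<B> Ss \<longleftrightarrow> set_system E Ss \<and> {I. is_transversal E Ss I} = \<B>"

definition transversal_matroid :: "'a set \<Rightarrow> 'a set set \<Rightarrow> bool" where
  "transversal_matroid E \<B> \<longleftrightarrow> (\<exists>Ss. presentation E \<B> Ss)"

definition minimal_presentation :: "'a set \<Rightarrow> 'a set set \<Rightarrow> 'a set list \<Rightarrow> bool" where
  "minimal_presentation E \<B> Ss \<longleftrightarrow> presentation E \<B> Ss \<and>
     (\<forall>Ts Ts'. presentation E \<B> Ts \<and> mset Ts' = mset Ts \<and> list_all2 (\<subseteq>) Ts' Ss
        \<longrightarrow> mset Ts = mset Ss)"


section \<open>Noncrossing set systems\<close>

text \<open>\<open>cyc_less a\<close> is the order \<open>a < a + 1 < \<dots> < n < 1 < \<dots> < a - 1\<close> on \<open>{1..n}\<close>.\<close>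

definition cyc_less :: "nat \<Rightarrow> nat \<Rightarrow> nat \<Rightarrow> bool" where
  "cyc_less a x y \<longleftrightarrow> (a \<le> x \<and> x < y) \<or> (y < a \<and> a \<le> x) \<or> (x < y \<and> y < a)"

definition crosses :: "nat \<Rightarrow> nat set \<Rightarrow> nat set \<Rightarrow> bool" where
  "crosses n S T \<longleftrightarrow>
     (\<exists>a \<in> {1..n}. \<exists>b \<in> {1..n}. \<exists>c \<in> {1..n}. \<exists>d \<in> {1..n}.
        cyc_less a a b \<and> cyc_less a b c \<and> cyc_less a c d \<and>
        a \<in> S \<and> c \<in> S \<and> a \<notin> T \<and> c \<notin> T \<and> b \<in> T \<and> d \<in> T \<and> b \<notin> S)"

definition noncrossing :: "nat \<Rightarrow> nat set list \<Rightarrow> bool" where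
  "noncrossing n Ss \<longleftrightarrow>
     \<not> (\<exists>i < length Ss. \<exists>j < length Ss. crosses n (Ss ! i) (Ss ! j))"

end

theory Submission
  imports Defs
begin

text \<open>Looplessness forces every column of the box to contain a bullet, so each vector of
  \<open>Meas(N_D)\<close> is nonzero and only its parallel class matters.  A column with a bullet only in
  the top row is parallel to the first source; along the bottom row, read from right to left,
  the slope of the vectors is constant except that it strictly grows at every column with
  bullets in both rows.  Hence the parallel classes are cyclic intervals: one for the top row,
  one for the second source and the only-bottom columns right of all two-bullet columns, and
  one for each two-bullet column with the only-bottom columns directly to its left.  The integer
  \<open>\<tau>\<close> counts exactly the classes with at least two elements.

  In a presentation \<open>(S, T)\<close> of a loopless rank 2 matroid every such class lies entirely in
  \<open>S - T\<close> or in \<open>T - S\<close>, and two different classes cannot lie in the same one, so there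
  are at most two of them.  Conversely, if distinct classes \<open>P\<close>, \<open>Q\<close> include all classes of
  size at least two, their complements form a minimal presentation, which is noncrossing
  because \<open>P\<close> and \<open>Q\<close> are cyclic intervals.\<close>

section \<open>Rank 2 matroids given by parallel classes\<close>

text \<open>A loopless matroid of rank 2 is determined by its partition into parallel classes, here
  the fibres of \<open>f\<close>; encoding the partition by a function lets the classes be numbered
  later. The family is empty when \<open>f\<close> is constant on \<open>E\<close>.\<close>

definition class_bases :: "'a set \<Rightarrow> ('a \<Rightarrow> 'b) \<Rightarrow> 'a set set" where
  "class_bases E f = {{x, y} | x y. x \<in> E \<and> y \<in> E \<and> f x \<noteq> f y}"

definition nontrivial_classes :: "'a set \<Rightarrow> ('a \<Rightarrow> 'b) \<Rightarrow> 'b set" where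
  "nontrivial_classes E f = {f x | x y. x \<in> E \<and> y \<in> E \<and> x \<noteq> y \<and> f x = f y}"

lemma doubleton_in_class_bases:
  "{x, y} \<in> class_bases E f \<longleftrightarrow> x \<in> E \<and> y \<in> E \<and> f x \<noteq> f y"
  by (auto simp: class_bases_def doubleton_eq_iff)

lemma is_transversal_pair:
  "is_transversal E [S, T] I \<longleftrightarrow>
     (\<exists>x y. x \<in> S \<inter> E \<and> y \<in> T \<inter> E \<and> x \<noteq> y \<and> I = {x, y})"
proof
  assume "is_transversal E [S, T] I"
  then obtain \<phi> where I: "I \<subseteq> E" and b: "bij_betw \<phi> {..<2} I"
    and m: "\<forall>j<2. \<phi> j \<in> [S, T] ! j"
    unfolding is_transversal_def by (auto simp: numeral_2_eq_2)
  have "{..<2} = {0, 1::nat}" by auto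
  then have "\<phi> 0 \<noteq> \<phi> 1" "I = {\<phi> 0, \<phi> 1}"
    using b by (auto simp: bij_betw_def)
  moreover have "\<phi> 0 \<in> S" "\<phi> 1 \<in> T" using m[rule_format, of 0] m[rule_format, of 1] by auto
  ultimately show "\<exists>x y. x \<in> S \<inter> E \<and> y \<in> T \<inter> E \<and> x \<noteq> y \<and> I = {x, y}"
    using I by blast
next
  assume "\<exists>x y. x \<in> S \<inter> E \<and> y \<in> T \<inter> E \<and> x \<noteq> y \<and> I = {x, y}"
  then obtain x y where xy: "x \<in> S \<inter> E" "y \<in> T \<inter> E" "x \<noteq> y" "I = {x, y}" by blast
  have "{..<length [S, T]} = {0, 1::nat}" by auto
  then have "bij_betw (\<lambda>j::nat. if j = 0 then x else y) {..<length [S, T]} I"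
    using xy by (auto simp: bij_betw_def inj_on_def)
  moreover have "\<forall>j<length [S, T]. (if j = 0 then x else y) \<in> [S, T] ! j"
    using xy by (auto simp: less_Suc_eq)
  ultimately show "is_transversal E [S, T] I"
    using xy unfolding is_transversal_def by blast
qed

text \<open>A basis has two elements, so a nonempty family of bases forces exactly two sets; a pair
  is then a basis when one of its elements can represent \<open>S\<close> and the other
  \<open>T\<close>.\<close>

lemma presentation_pair:
  assumes "presentation E (class_bases E f) Ss" and "class_bases E f \<noteq> {}"
  obtains S T where "Ss = [S, T]" "S \<subseteq> E" "T \<subseteq> E"
    "\<forall>x\<in>E. \<forall>y\<in>E. f x \<noteq> f y \<longleftrightarrow>
       x \<noteq> y \<and> (x \<in> S \<and> y \<in> T \<or> x \<in> T \<and> y \<in> S)"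
proof -
  have bases: "{I. is_transversal E Ss I} = class_bases E f"
    using assms(1) by (simp add: presentation_def)
  obtain B where B: "B \<in> class_bases E f" using assms(2) by blast
  then have "is_transversal E Ss B" using bases by blast
  then have "card B = length Ss"
    unfolding is_transversal_def by (metis bij_betw_same_card card_lessThan)
  moreover have "card B = 2" using B by (auto simp: class_bases_def card_2_iff)
  ultimately have "length Ss = Suc (Suc 0)" by simp
  then obtain S T where Ss: "Ss = [S, T]" by (auto simp: length_Suc_conv)
  have "S \<subseteq> E" "T \<subseteq> E"
    using assms(1) Ss by (auto simp: presentation_def set_system_def)
  moreover have "f x \<noteq> f y \<longleftrightarrow> x \<noteq> y \<and> (x \<in> S \<and> y \<in> T \<or> x \<in> T \<and> y \<in> S)"
    if "x \<in> E" "y \<in> E" for x y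
  proof -
    have "f x \<noteq> f y \<longleftrightarrow> is_transversal E [S, T] {x, y}"
      using bases that doubleton_in_class_bases[of x y E f] Ss by blast
    also have "\<dots> \<longleftrightarrow> x \<noteq> y \<and> (x \<in> S \<and> y \<in> T \<or> x \<in> T \<and> y \<in> S)"
      using that unfolding is_transversal_pair doubleton_eq_iff by blast
    finally show ?thesis .
  qed
  ultimately show ?thesis by (intro that[OF Ss]) blast+
qed

text \<open>The nontrivial classes inject into \<open>bool\<close> by recording which of the two
  presenting sets contains them.\<close>

lemma card_nontrivial_classes_le_2:
  assumes "transversal_matroid E (class_bases E f)" and "class_bases E f \<noteq> {}"
  shows "card (nontrivial_classes E f) \<le> 2"
proof -
  obtain Ss where "presentation E (class_bases E f) Ss"
    using assms(1) by (auto simp: transversal_matroid_def)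
  then obtain S T where ST: "S \<subseteq> E" "T \<subseteq> E" and
    *: "\<forall>x\<in>E. \<forall>y\<in>E. f x \<noteq> f y \<longleftrightarrow>
       x \<noteq> y \<and> (x \<in> S \<and> y \<in> T \<or> x \<in> T \<and> y \<in> S)"
    using assms(2) by (rule presentation_pair) (rule that)
  obtain u v where uv: "u \<in> E" "v \<in> E" "f u \<noteq> f v"
    using assms(2) by (auto simp: class_bases_def)
  \<comment> \<open>\<open>x\<close> differs in class from at least one of \<open>u\<close> and
    \<open>v\<close>, hence lies in a basis.\<close>
  have cover: "x \<in> S \<or> x \<in> T" if "x \<in> E" for x
    using that uv *[rule_format, of x u] *[rule_format, of x v] by auto
  \<comment> \<open>An element of both sets would form a transversal with its parallel partner,
    which lies in one of them.\<close>
  have one_set: "x \<notin> S \<or> x \<notin> T" if "x \<in> E" "y \<in> E" "x \<noteq> y" "f x = f y" for x y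
    using that cover[of y] *[rule_format, of x y] by auto
  define side where "side k = (\<exists>x\<in>S. f x = k)" for k
  have "inj_on side (nontrivial_classes E f)"
  proof (rule inj_onI)
    fix k l
    assume kl: "k \<in> nontrivial_classes E f" "l \<in> nontrivial_classes E f" "side k = side l"
    obtain x x' where x: "x \<in> E" "x' \<in> E" "x \<noteq> x'" "f x = f x'" "k = f x"
      using kl(1) by (auto simp: nontrivial_classes_def)
    obtain y y' where y: "y \<in> E" "y' \<in> E" "y \<noteq> y'" "f y = f y'" "l = f y"
      using kl(2) by (auto simp: nontrivial_classes_def)
    show "k = l"
    proof (cases "side k")
      case True
      then obtain a b where "a \<in> S" "f a = k" "b \<in> S" "f b = l"
        using kl(3) unfolding side_def by auto
      \<comment> \<open>Since \<open>a\<close> may coincide with \<open>x\<close> or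
        \<open>x'\<close>, both are offered as its distinct parallel partner; likewise for
        \<open>b\<close>.\<close>
      moreover from this have "a \<notin> T" "b \<notin> T"
        using one_set[of a x] one_set[of a x'] one_set[of b y] one_set[of b y'] x y ST by auto
      ultimately show ?thesis using *[rule_format, of a b] ST by auto
    next
      case False
      then have "x \<notin> S" "y \<notin> S" using kl(3) x(5) y(5) unfolding side_def by auto
      then show ?thesis using *[rule_format, of x y] x y by auto
    qed
  qed
  then have "card (nontrivial_classes E f) \<le> card (UNIV :: bool set)"
    by (intro card_inj_on_le[of side]) auto
  then show ?thesis by simp
qed

text \<open>Distinct parallel elements lie in the class of \<open>p\<close> or of \<open>q\<close>,
  and each of these two classes meets only one of the two sets, so such elements never form a
  transversal.\<close>

lemma minimal_presentation_complements:
  assumes P: "p \<in> E" and Q: "q \<in> E" and PQ: "f p \<noteq> f q"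
    and triv: "nontrivial_classes E f \<subseteq> {f p, f q}"
  shows "minimal_presentation E (class_bases E f)
    [{x \<in> E. f x \<noteq> f q}, {x \<in> E. f x \<noteq> f p}]" (is "minimal_presentation E ?B [?S, ?T]")
proof -
  have tr: "is_transversal E [?S, ?T] I \<longleftrightarrow> I \<in> ?B" for I
  proof
    assume "is_transversal E [?S, ?T] I"
    then obtain x y where xy: "x \<in> ?S" "y \<in> ?T" "x \<noteq> y" "I = {x, y}"
      by (auto simp: is_transversal_pair)
    have "f x \<noteq> f y"
    proof
      assume "f x = f y"
      then have "f x \<in> nontrivial_classes E f"
        using xy unfolding nontrivial_classes_def by blast
      then show False using triv xy \<open>f x = f y\<close> by auto
    qed
    then show "I \<in> ?B" using xy by (auto simp: doubleton_in_class_bases)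
  next
    assume "I \<in> ?B"
    then obtain x y where xy: "x \<in> E" "y \<in> E" "f x \<noteq> f y" "I = {x, y}"
      by (auto simp: class_bases_def)
    then have "x \<noteq> y" and "x \<in> ?S \<and> y \<in> ?T \<or> y \<in> ?S \<and> x \<in> ?T"
      using PQ by auto
    then show "is_transversal E [?S, ?T] I"
      unfolding is_transversal_pair xy(4) by (auto simp: doubleton_eq_iff)
  qed
  have "{p, q} \<in> ?B" using P Q PQ by (simp add: doubleton_in_class_bases)
  then have ne: "?B \<noteq> {}" and pres: "presentation E ?B [?S, ?T]"
    using tr unfolding presentation_def set_system_def by auto
  have "mset Ts = mset [?S, ?T]"
    if Ts: "presentation E ?B Ts" and perm: "mset Ts' = mset Ts"
      and sub: "list_all2 (\<subseteq>) Ts' [?S, ?T]" for Ts Ts'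
  proof -
    obtain U V where UV: "Ts = [U, V]" and
      *: "\<forall>x\<in>E. \<forall>y\<in>E. f x \<noteq> f y \<longleftrightarrow>
         x \<noteq> y \<and> (x \<in> U \<and> y \<in> V \<or> x \<in> V \<and> y \<in> U)"
      using Ts ne by (rule presentation_pair) (rule that)
    obtain U' V' where Ts': "Ts' = [U', V']" and sub': "U' \<subseteq> ?S" "V' \<subseteq> ?T"
      using sub by (auto simp: list_all2_Cons2)
    \<comment> \<open>The permutation may swap the two sets, but the basis condition is symmetric in
      them.\<close>
    have "U' = U \<and> V' = V \<or> U' = V \<and> V' = U"
      using perm unfolding UV Ts' by (auto simp: add_eq_conv_ex)
    then have **: "f x \<noteq> f y \<longleftrightarrow> x \<noteq> y \<and> (x \<in> U' \<and> y \<in> V' \<or> x \<in> V' \<and> y \<in> U')"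
      if "x \<in> E" "y \<in> E" for x y
      using *[rule_format, OF that] by blast
    \<comment> \<open>\<open>p\<close> and \<open>q\<close> are each allowed in only one of the
      smaller sets. Every \<open>x\<close> in \<open>?S\<close> forms a basis with \<open>q\<close>,
      which is represented in \<open>V'\<close> only, so \<open>x\<close> must be in
      \<open>U'\<close>; symmetrically for \<open>?T\<close> and \<open>p\<close>.\<close>
    have pU: "p \<in> U'" "p \<notin> V'" and qV: "q \<in> V'" "q \<notin> U'"
      using **[OF P Q] PQ sub' by auto
    have "x \<in> U'" if "x \<in> ?S" for x
      using **[OF _ Q, of x] that qV by auto
    moreover have "x \<in> V'" if "x \<in> ?T" for x
      using **[OF _ P, of x] that pU by auto
    ultimately have "U' = ?S" "V' = ?T" using sub' by blast+
    then show ?thesis using perm Ts' by simp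
  qed
  with pres show ?thesis unfolding minimal_presentation_def by blast
qed

text \<open>If there are fewer than two nontrivial classes, the pair is padded with other classes; a
  basis guarantees that two classes exist.\<close>

lemma card_nontrivial_classes_le_2_obtain:
  assumes "finite E" and "class_bases E f \<noteq> {}" and "card (nontrivial_classes E f) \<le> 2"
  obtains p q where "p \<in> E" "q \<in> E" "f p \<noteq> f q" "nontrivial_classes E f \<subseteq> {f p, f q}"
proof -
  obtain u v where uv: "u \<in> E" "v \<in> E" "f u \<noteq> f v"
    using assms(2) by (auto simp: class_bases_def)
  have "card {f u, f v} \<le> card (f ` E)"
    using uv assms(1) by (intro card_mono) auto
  then have "2 \<le> card (f ` E)" using uv by simp
  moreover have "nontrivial_classes E f \<subseteq> f ` E" by (auto simp: nontrivial_classes_def)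
  ultimately obtain C where C: "nontrivial_classes E f \<subseteq> C" "C \<subseteq> f ` E" "card C = 2"
    using exists_subset_between[of "nontrivial_classes E f" 2 "f ` E"] assms(1,3) by auto
  then obtain k l where "C = {k, l}" "k \<noteq> l" by (auto simp: card_2_iff)
  then show ?thesis using C that by auto
qed

text \<open>Each class is an interval in the cyclic order. Both diagonals of an increasing quadruple
  are listed, so that the condition is invariant under rotation.\<close>

definition cyclic_classes :: "nat \<Rightarrow> (nat \<Rightarrow> 'b) \<Rightarrow> bool" where
  "cyclic_classes n f \<longleftrightarrow> (\<forall>x1 x2 x3 x4. 1 \<le> x1 \<and> x1 < x2 \<and> x2 < x3 \<and> x3 < x4 \<and> x4 \<le> n \<longrightarrow>
     (f x1 = f x3 \<longrightarrow> f x2 = f x1 \<or> f x4 = f x1) \<and>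
     (f x2 = f x4 \<longrightarrow> f x1 = f x2 \<or> f x3 = f x2))"

text \<open>The part of the first complement outside the second is exactly the class of
  \<open>p\<close>, so a crossing would have elements outside this class on both cyclic arcs between
  two of its members.\<close>

lemma not_crosses_complements:
  assumes "cyclic_classes n f" and "f p \<noteq> f q"
  shows "\<not> crosses n {x \<in> {1..n}. f x \<noteq> f q} {x \<in> {1..n}. f x \<noteq> f p}"
proof
  assume "crosses n {x \<in> {1..n}. f x \<noteq> f q} {x \<in> {1..n}. f x \<noteq> f p}"
  then obtain a b c d where r: "a \<in> {1..n}" "b \<in> {1..n}" "c \<in> {1..n}" "d \<in> {1..n}"
    and cyc: "cyc_less a a b" "cyc_less a b c" "cyc_less a c d"
    and f: "f a = f p" "f c = f p" "f b \<noteq> f p" "f d \<noteq> f p"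
    unfolding crosses_def by auto
  \<comment> \<open>The order starting at \<open>a\<close> unrolls into one of the four rotations of
    an increasing quadruple.\<close>
  have "a < b \<and> b < c \<and> c < d \<or> b < c \<and> c < d \<and> d < a \<or>
        c < d \<and> d < a \<and> a < b \<or> d < a \<and> a < b \<and> b < c"
    using cyc unfolding cyc_less_def by linarith
  moreover note key = assms(1)[unfolded cyclic_classes_def, rule_format]
  ultimately show False
    using key[of a b c d] key[of b c d a] key[of c d a b] key[of d a b c] r f by auto
qed

lemma noncrossing_pair:
  "noncrossing n [S, T] \<longleftrightarrow> \<not> crosses n S T \<and> \<not> crosses n T S"
proof -
  have self: "\<not> crosses n U U" for U unfolding crosses_def by blast
  have "(\<exists>i<length [S, T]. P i) \<longleftrightarrow> P 0 \<or> P 1" for P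
    by (auto simp: less_Suc_eq)
  then show ?thesis unfolding noncrossing_def by (simp add: self)
qed

lemma transversal_cyclic_classes:
  assumes "cyclic_classes n f" and "class_bases {1..n} f \<noteq> {}"
  shows "transversal_matroid {1..n} (class_bases {1..n} f) \<longleftrightarrow>
      card (nontrivial_classes {1..n} f) \<le> 2"
    and "transversal_matroid {1..n} (class_bases {1..n} f) \<Longrightarrow>
      \<exists>Ss. minimal_presentation {1..n} (class_bases {1..n} f) Ss \<and> noncrossing n Ss"
proof -
  let ?B = "class_bases {1..n} f"
  have *: "\<exists>Ss. minimal_presentation {1..n} ?B Ss \<and> noncrossing n Ss"
    if le2: "card (nontrivial_classes {1..n} f) \<le> 2"
  proof -
    obtain p q where pq: "p \<in> {1..n}" "q \<in> {1..n}" "f p \<noteq> f q"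
      "nontrivial_classes {1..n} f \<subseteq> {f p, f q}"
      using card_nontrivial_classes_le_2_obtain[OF _ assms(2) le2] by blast
    show ?thesis
      using minimal_presentation_complements[OF pq] noncrossing_pair
        not_crosses_complements[OF assms(1) pq(3)] not_crosses_complements[OF assms(1) pq(3)[symmetric]]
      by blast
  qed
  moreover have "transversal_matroid {1..n} ?B" if "minimal_presentation {1..n} ?B Ss" for Ss
    using that by (auto simp: transversal_matroid_def minimal_presentation_def)
  ultimately show "transversal_matroid {1..n} ?B \<longleftrightarrow> card (nontrivial_classes {1..n} f) \<le> 2"
    using card_nontrivial_classes_le_2[OF _ assms(2)] by blast
  then show "transversal_matroid {1..n} ?B \<Longrightarrow>
      \<exists>Ss. minimal_presentation {1..n} ?B Ss \<and> noncrossing n Ss"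
    using * by blast
qed

section \<open>Path sums in acyclic digraphs\<close>

lemma det_mat_2:
  fixes g :: "nat \<times> nat \<Rightarrow> 'a::comm_ring_1"
  shows "det (mat 2 2 g) = g (0, 0) * g (1, 1) - g (0, 1) * g (1, 0)"
proof -
  have A: "mat 2 2 g \<in> carrier_mat 2 2" by simp
  have "det (mat 2 2 g) =
    (\<Sum>i<2. mat 2 2 g $$ (i, 0) * cofactor (mat 2 2 g) i 0)"
    by (rule laplace_expansion_column[OF A]) simp
  then show ?thesis
    by (simp add: numeral_2_eq_2 cofactor_def mat_delete_def det_single)
qed

text \<open>The sign in \<open>meas\<close> depends only on the two endpoints and factors out, so
  the unsigned sum is what has to be computed.\<close>

definition path_sum ::
    "('a, 'b) pre_digraph \<Rightarrow> ('b \<Rightarrow> real) \<Rightarrow> 'a \<Rightarrow> 'a \<Rightarrow> real" where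
  "path_sum G w u v = (\<Sum>p | pre_digraph.apath G u p v. prod_list (map w p))"

context fin_digraph
begin

lemma path_sum_refl: "u \<in> verts G \<Longrightarrow> path_sum G w u u = 1"
proof -
  assume "u \<in> verts G"
  then have "{p. apath u p u} = {[]}"
    using apath_nonempty_ends[of u _ u] by (auto simp: apath_Nil_iff)
  then show ?thesis by (simp add: path_sum_def)
qed

text \<open>In an acyclic digraph, deleting the last arc of a path is a bijection.\<close>

lemma path_sum_last_arc:
  fixes rk :: "'a \<Rightarrow> nat"
  assumes rk: "\<And>e. e \<in> arcs G \<Longrightarrow> rk (tail G e) < rk (head G e)" and "u \<noteq> v"
  shows "path_sum G w u v =
    (\<Sum>e | e \<in> arcs G \<and> head G e = v. path_sum G w u (tail G e) * w e)"
proof -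
  \<comment> \<open>\<open>rk\<close> grows along walks, so no vertex of a walk ranks above its
    end.\<close>
  have rk_le: "rk x \<le> rk v'" if "cas u' q v'" "set q \<subseteq> arcs G" "x \<in> set (awalk_verts u' q)"
    for u' q v' x using that
  proof (induction q arbitrary: u' x)
    case (Cons e q)
    have "awalk_verts (head G e) q = head G e # tl (awalk_verts (head G e) q)"
      using Cons.prems(1) by (cases q) auto
    then have "head G e \<in> set (awalk_verts (head G e) q)"
      by (metis list.set_intros(1))
    then have "rk (head G e) \<le> rk v'" using Cons.IH[of "head G e" "head G e"] Cons.prems by auto
    moreover have "rk (tail G e) < rk (head G e)" using rk Cons.prems by auto
    ultimately show ?case
      using Cons.IH[of "head G e" x] Cons.prems by auto
  qed auto
  have snoc: "apath u (q @ [e]) v \<longleftrightarrow> apath u q (tail G e) \<and> e \<in> arcs G \<and> head G e = v" for q e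
  proof -
    \<comment> \<open>The head of the appended arc ranks strictly above every vertex of
      \<open>q\<close>, so the extended walk is still simple.\<close>
    have "v \<notin> set (awalk_verts u q)" if "apath u q (tail G e)" "e \<in> arcs G" "head G e = v"
      using that rk_le[of u q "tail G e" v] rk[of e] by (auto simp: apath_def awalk_def)
    moreover have "awalk_verts u (q @ [e]) = awalk_verts u q @ [head G e]" if "cas u q (tail G e)"
      using that by (induction q arbitrary: u) auto
    ultimately show ?thesis
      by (auto simp: apath_def awalk_def)
  qed
  let ?In = "{e. e \<in> arcs G \<and> head G e = v}"
  have "{p. apath u p v} = (\<Union>e\<in>?In. (\<lambda>q. q @ [e]) ` {q. apath u q (tail G e)})"
  proof (intro equalityI subsetI)
    fix p assume p: "p \<in> {p. apath u p v}"
    then have "p \<noteq> []" using \<open>u \<noteq> v\<close> by (auto simp: apath_Nil_iff)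
    then obtain q e where "p = q @ [e]" by (metis rev_exhaust)
    then show "p \<in> (\<Union>e\<in>?In. (\<lambda>q. q @ [e]) ` {q. apath u q (tail G e)})"
      using p snoc by auto
  qed (use snoc in auto)
  then have "path_sum G w u v =
    (\<Sum>e\<in>?In. \<Sum>p\<in>(\<lambda>q. q @ [e]) ` {q. apath u q (tail G e)}. prod_list (map w p))"
    unfolding path_sum_def by (simp only:) (rule sum.UNION_disjoint; auto simp: apaths_finite)
  also have "\<dots> = (\<Sum>e\<in>?In. path_sum G w u (tail G e) * w e)"
    unfolding path_sum_def
    by (intro sum.cong refl) (simp add: sum.reindex inj_on_def sum_distrib_right)
  finally show ?thesis .
qed

end

section \<open>Parallel classes and the integer tau\<close>

text \<open>The normal form that the Le-condition and looplessness impose: a full top row, bottom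
  bullets forming a right-justified block, and a top bullet in every column outside this block. Here
  \<open>l\<close> is the length of the bottom row and \<open>p\<close> the number of its empty
  boxes.\<close>

locale two_row_diagram =
  fixes n p l :: nat and D :: filled_diagram
  assumes n_ge_2: "2 \<le> n" and p_le_l: "p \<le> l" and l_le: "l \<le> n - 2"
    and boxes: "boxes D = {1} \<times> {1..n - 2} \<union> {2} \<times> {1..l}"
    and bullets_rows: "bullets D \<subseteq> {1, 2} \<times> {1..n - 2}"
    and bullets_bottom: "(2, c) \<in> bullets D \<longleftrightarrow> p < c \<and> c \<le> l"
    and bullets_top: "1 \<le> c \<Longrightarrow> c \<le> n - 2 \<Longrightarrow> c \<le> p \<or> l < c \<Longrightarrow> (1, c) \<in> bullets D"
begin

section \<open>Counting two-bullet columns and labelling the parallel classes\<close>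

lemma both_rows_bounds: "both_rows D c \<Longrightarrow> p < c \<and> c \<le> l"
  by (simp add: both_rows_def bullets_bottom)

lemma only_bottom_iff: "only_bottom D c \<longleftrightarrow> p < c \<and> c \<le> l \<and> \<not> both_rows D c"
  by (auto simp: only_bottom_def both_rows_def bullets_bottom)

lemma only_top_iff: "only_top D c \<longleftrightarrow> 1 \<le> c \<and> c \<le> n - 2 \<and> \<not> (p < c \<and> c \<le> l)"
  using bullets_rows bullets_top[of c] by (auto simp: only_top_def bullets_bottom)

text \<open>The number of slope jumps met on the bottom row when it is read from its right end up to
  and including column \<open>c\<close>.\<close>

definition both_count :: "nat \<Rightarrow> nat" where
  "both_count c = card {x. both_rows D x \<and> c \<le> x}"

lemma finite_both: "finite {x. both_rows D x \<and> c \<le> x}"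
  by (rule finite_subset[of _ "{..l}"]) (auto dest: both_rows_bounds)

lemma both_count_antimono: "c \<le> c' \<Longrightarrow> both_count c' \<le> both_count c"
  unfolding both_count_def by (intro card_mono finite_both) auto

text \<open>The two counted sets are nested and finite, so equal counts mean equal sets.\<close>

lemma both_count_eq_iff:
  assumes "c \<le> c'"
  shows "both_count c = both_count c' \<longleftrightarrow> (\<forall>x. c \<le> x \<and> x < c' \<longrightarrow> \<not> both_rows D x)"
proof
  assume "both_count c = both_count c'"
  then have "{x. both_rows D x \<and> c' \<le> x} = {x. both_rows D x \<and> c \<le> x}"
    unfolding both_count_def using assms by (intro card_subset_eq finite_both) auto
  then show "\<forall>x. c \<le> x \<and> x < c' \<longrightarrow> \<not> both_rows D x"
    using leD by blast
next
  assume "\<forall>x. c \<le> x \<and> x < c' \<longrightarrow> \<not> both_rows D x"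
  then have "{x. both_rows D x \<and> c' \<le> x} = {x. both_rows D x \<and> c \<le> x}"
    using assms by (auto simp: not_le[symmetric] intro: order_trans)
  then show "both_count c = both_count c'" by (simp add: both_count_def)
qed

lemma both_count_Suc:
  "both_count c = both_count (Suc c) + (if both_rows D c then 1 else 0)"
proof (cases "both_rows D c")
  case True
  then have "{x. both_rows D x \<and> c \<le> x} = insert c {x. both_rows D x \<and> Suc c \<le> x}"
    by (auto simp: Suc_le_eq)
  then show ?thesis using True finite_both[of "Suc c"] by (simp add: both_count_def)
next
  case False
  then have "both_count c = both_count (Suc c)"
    by (subst both_count_eq_iff) (auto simp: less_Suc_eq_le dest: le_antisym)
  then show ?thesis using False by simp
qed

lemma both_count_eq_0_iff: "both_count c = 0 \<longleftrightarrow> (\<forall>x\<ge>c. \<not> both_rows D x)"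
  using finite_both[of c] by (auto simp: both_count_def)

text \<open>Columns \<open>p < c \<le> l\<close> carry the labels \<open>n + 1 - c\<close>, and the second source has label
  \<open>n - l\<close>; all other labels give multiples of the first source's vector.\<close>

definition label_class :: "nat \<Rightarrow> nat" where
  "label_class j = (if j < n - l \<or> n - p < j then 0 else Suc (both_count (n + 1 - j)))"

text \<open>The labels of nonzero class form the interval from \<open>n - l\<close> to
  \<open>n - p\<close>, on which the class is weakly increasing. Hence each nonzero class is an
  interval, and class 0 is the complement of one.\<close>

lemma cyclic_label_class: "cyclic_classes n label_class"
proof -
  have mono: "label_class x \<le> label_class y" if "x \<le> y" "y \<le> n - p" for x y
    using that both_count_antimono[of "n + 1 - y" "n + 1 - x"] by (auto simp: label_class_def)
  have pos: "label_class x \<noteq> 0 \<longleftrightarrow> n - l \<le> x \<and> x \<le> n - p" for x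
    by (auto simp: label_class_def)
  have between: "label_class y = label_class x"
    if "x < y" "y < z" "label_class x = label_class z" "label_class x \<noteq> 0" for x y z
    using that mono[of x y] mono[of y z] pos[of z] by force
  have convex: "label_class y \<noteq> 0"
    if "x < y" "y < z" "label_class x \<noteq> 0" "label_class z \<noteq> 0" for x y z
    using that pos by (meson less_le_not_le order_trans)
  show ?thesis
    unfolding cyclic_classes_def
  proof (intro allI impI conjI)
    fix x1 x2 x3 x4
    assume x: "1 \<le> x1 \<and> x1 < x2 \<and> x2 < x3 \<and> x3 < x4 \<and> x4 \<le> n"
    show "label_class x2 = label_class x1 \<or> label_class x4 = label_class x1"
      if "label_class x1 = label_class x3"
      using between[of x1 x2 x3] convex[of x2 x3 x4] that x by metis
    show "label_class x1 = label_class x2 \<or> label_class x3 = label_class x2"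
      if "label_class x2 = label_class x4"
      using between[of x2 x3 x4] convex[of x1 x2 x3] that x by metis
  qed
qed

section \<open>Occurrences of L(i) as runs of only-bottom columns\<close>

lemma subdiagram_eq_L_diagram_iff:
  "subdiagram D s (i + 1) = L_diagram i \<longleftrightarrow>
     both_rows D (s + i + 1) \<and> (\<forall>x. s < x \<and> x \<le> s + i \<longrightarrow> only_bottom D x)"
proof
  assume "subdiagram D s (i + 1) = L_diagram i"
  then have "{(r, c). c \<in> {1..i + 1} \<and> (r, s + c) \<in> bullets D} =
      {2} \<times> {1..i + 1} \<union> {(1, i + 1)}"
    by (simp add: subdiagram_def L_diagram_def)
  then have *: "c \<in> {1..i + 1} \<and> (r, s + c) \<in> bullets D \<longleftrightarrow>
      r = 2 \<and> c \<in> {1..i + 1} \<or> r = 1 \<and> c = i + 1" for r c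
    unfolding set_eq_iff by (auto dest!: spec[of _ "(r, c)"])
  have "both_rows D (s + i + 1)"
    using *[of "i + 1" 1] *[of "i + 1" 2] by (simp add: both_rows_def add.assoc)
  moreover have "only_bottom D x" if "s < x" "x \<le> s + i" for x
    using *[of "x - s" 1] *[of "x - s" 2] that by (auto simp: only_bottom_def)
  ultimately show "both_rows D (s + i + 1) \<and> (\<forall>x. s < x \<and> x \<le> s + i \<longrightarrow> only_bottom D x)"
    by blast
next
  assume r: "both_rows D (s + i + 1) \<and> (\<forall>x. s < x \<and> x \<le> s + i \<longrightarrow> only_bottom D x)"
  then have le: "s + i + 1 \<le> l" using both_rows_bounds by blast
  have "(r, s + c) \<in> bullets D \<longleftrightarrow> r = 2 \<or> r = 1 \<and> c = i + 1"
    if "1 \<le> c" "c \<le> i + 1" for r c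
  proof (cases "c = i + 1")
    case True
    then show ?thesis using r bullets_rows by (auto simp: both_rows_def add.assoc)
  next
    case False
    then have "only_bottom D (s + c)" using r that by auto
    then show ?thesis using False bullets_rows by (auto simp: only_bottom_def)
  qed
  then have "{(r, c). c \<in> {1..i + 1} \<and> (r, s + c) \<in> bullets D} =
      {2} \<times> {1..i + 1} \<union> {(1, i + 1)}"
    by auto
  \<comment> \<open>The window ends in a two-bullet column, which lies at or before column
    \<open>l\<close>, so all its columns have boxes in both rows.\<close>
  moreover have "{(r, c). c \<in> {1..i + 1} \<and> (r, s + c) \<in> boxes D} = {1, 2} \<times> {1..i + 1}"
    using le l_le unfolding boxes by auto
  ultimately show "subdiagram D s (i + 1) = L_diagram i"
    unfolding subdiagram_def L_diagram_def by simp
qed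

lemma maximal_Ls_iff:
  "(s, i) \<in> maximal_Ls D \<longleftrightarrow> 1 \<le> i \<and> both_rows D (s + i + 1) \<and>
     (\<forall>x. s < x \<and> x \<le> s + i \<longrightarrow> only_bottom D x) \<and> \<not> only_bottom D s"
proof -
  have "(\<exists>s'. s = s' + 1 \<and> subdiagram D s' (i + 2) = L_diagram (i + 1)) \<longleftrightarrow>
      both_rows D (s + i + 1) \<and> only_bottom D s \<and> (\<forall>x. s < x \<and> x \<le> s + i \<longrightarrow> only_bottom D x)"
  proof (cases s)
    \<comment> \<open>No column lies to the left of the window, and the fictitious column 0 is not
      only-bottom because \<open>p < 0\<close> fails.\<close>
    case 0
    then show ?thesis by (simp add: only_bottom_iff)
  next
    case (Suc s')
    have "(\<forall>x. s' < x \<and> x \<le> s' + (i + 1) \<longrightarrow> only_bottom D x) \<longleftrightarrow>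
        only_bottom D s \<and> (\<forall>x. s < x \<and> x \<le> s + i \<longrightarrow> only_bottom D x)"
    proof -
      have "s' < x \<and> x \<le> s' + (i + 1) \<longleftrightarrow> x = s \<or> s < x \<and> x \<le> s + i" for x
        unfolding Suc by auto
      then show ?thesis by metis
    qed
    then show ?thesis
      using subdiagram_eq_L_diagram_iff[of s' "i + 1"] by (simp add: Suc)
  qed
  then show ?thesis
    unfolding maximal_Ls_def using subdiagram_eq_L_diagram_iff[of s i] by auto
qed

lemma maximal_L_extends_left:
  assumes "both_rows D x" "c < x" "\<And>y. c \<le> y \<Longrightarrow> y < x \<Longrightarrow> only_bottom D y"
  obtains s i where "(s, i) \<in> maximal_Ls D" "s + i + 1 = x" "s < c"
proof -
  let ?S = "{y. y < x \<and> \<not> only_bottom D y}"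
  \<comment> \<open>The last column before \<open>x\<close> that breaks the run of only-bottom
    columns; column 0 always does, so the maximum exists.\<close>
  define s where "s = Max ?S"
  have fin: "finite ?S" by simp
  have "\<not> only_bottom D 0" by (simp add: only_bottom_iff)
  then have "0 \<in> ?S" using assms(2) by auto
  then have s: "s \<in> ?S" using Max_in[OF fin] unfolding s_def by blast
  have run: "only_bottom D y" if "s < y" "y < x" for y
  proof (rule ccontr)
    assume "\<not> only_bottom D y"
    then have "y \<le> Max ?S" using that by (intro Max_ge fin) simp
    then show False using that unfolding s_def by simp
  qed
  have "s < c" using s assms(3)[of s] by (auto simp: not_le[symmetric])
  moreover have "(s, x - s - 1) \<in> maximal_Ls D"
    unfolding maximal_Ls_iff using s run assms(1,2) \<open>s < c\<close> by auto
  moreover have "s + (x - s - 1) + 1 = x" using \<open>s < c\<close> assms(2) by simp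
  ultimately show ?thesis using that by blast
qed

lemma covered_columns_iff:
  "c \<in> covered_columns D \<longleftrightarrow> (\<exists>s i. (s, i) \<in> maximal_Ls D \<and> s < c \<and> c \<le> s + i + 1)"
proof -
  have "c \<in> covered_columns D \<longleftrightarrow> (\<exists>(s, i)\<in>maximal_Ls D. s < c \<and> c \<le> s + i + 1)"
    unfolding covered_columns_def by (auto simp: Suc_le_eq split: prod.splits)
  then show ?thesis by blast
qed

lemma first_both_after:
  assumes "both_rows D z" "c \<le> z"
  obtains x where "both_rows D x" "c \<le> x" "\<And>y. c \<le> y \<Longrightarrow> y < x \<Longrightarrow> \<not> both_rows D y"
proof -
  define x where "x = (LEAST x. both_rows D x \<and> c \<le> x)"
  have "both_rows D x \<and> c \<le> x" unfolding x_def by (rule LeastI[of _ z]) (use assms in simp)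
  moreover have "\<not> both_rows D y" if "c \<le> y" "y < x" for y
    using not_less_Least[of y "\<lambda>x. both_rows D x \<and> c \<le> x"] that unfolding x_def by blast
  ultimately show ?thesis using that by blast
qed

text \<open>Label 1, the first source, is always in class 0, so the class is nontrivial as soon as
  one only-top column exists. Covered columns have a bottom bullet, so an only-top column is never
  covered.\<close>

lemma uncovered_only_top_iff:
  "(\<exists>c. c \<notin> covered_columns D \<and> only_top D c) \<longleftrightarrow> 0 \<in> nontrivial_classes {1..n} label_class"
proof
  assume "\<exists>c. c \<notin> covered_columns D \<and> only_top D c"
  then obtain c where c: "1 \<le> c" "c \<le> n - 2" "\<not> (p < c \<and> c \<le> l)"
    by (auto simp: only_top_iff)
  \<comment> \<open>The sink label of column \<open>c\<close>: columns up to \<open>p\<close> meet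
    both rows, columns beyond \<open>l\<close> only the top row, which shifts the label by
    one.\<close>
  define j where "j = (if c \<le> p then n + 1 - c else n - c)"
  have "label_class 1 = 0" "label_class j = 0" "1 \<noteq> j" "j \<in> {1..n}"
    using c n_ge_2 l_le p_le_l by (auto simp: label_class_def j_def)
  then show "0 \<in> nontrivial_classes {1..n} label_class"
    using n_ge_2 unfolding nontrivial_classes_def by force
next
  assume "0 \<in> nontrivial_classes {1..n} label_class"
  then obtain x y where "x \<in> {1..n}" "y \<in> {1..n}" "x \<noteq> y" "label_class x = 0" "label_class y = 0"
    by (auto simp: nontrivial_classes_def)
  then obtain j where j: "2 \<le> j" "j \<le> n" "label_class j = 0"
    by (metis Suc_1 Suc_leI atLeastAtMost_iff le_neq_implies_less)
  \<comment> \<open>The column whose sink has label \<open>j\<close>, inverting the two cases of the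
    sink label.\<close>
  define c where "c = (if n - p < j then n + 1 - j else n - j)"
  have "only_top D c"
    using j l_le p_le_l by (auto simp: only_top_iff c_def label_class_def split: if_splits)
  moreover have "c \<notin> covered_columns D"
  proof
    assume "c \<in> covered_columns D"
    then obtain s i where si: "(s, i) \<in> maximal_Ls D" "s < c" "c \<le> s + i + 1"
      by (auto simp: covered_columns_iff)
    then have "only_bottom D c \<or> both_rows D c"
      unfolding maximal_Ls_iff by (metis Suc_eq_plus1 le_Suc_eq)
    then show False using \<open>only_top D c\<close> by (auto simp: only_top_def only_bottom_def both_rows_def)
  qed
  ultimately show "\<exists>c. c \<notin> covered_columns D \<and> only_top D c" by blast
qed

text \<open>Both sides amount to \<open>only_bottom D l\<close>. An only-bottom column with a
  two-bullet column to its right is covered by the run ending at the first such column. Class 1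
  always contains the second source \<open>n - l\<close>, and gains another member exactly when
  column \<open>l\<close>, with label \<open>n - l + 1\<close>, is only-bottom.\<close>

lemma uncovered_only_bottom_iff:
  "(\<exists>c. c \<notin> covered_columns D \<and> only_bottom D c \<and>
       (\<forall>c'. c' \<notin> covered_columns D \<and> both_rows D c' \<longrightarrow> c' < c)) \<longleftrightarrow>
     1 \<in> nontrivial_classes {1..n} label_class" (is "?L \<longleftrightarrow> ?R")
proof -
  have "?L \<longleftrightarrow> only_bottom D l"
  proof
    assume ?L
    then obtain c where c: "c \<notin> covered_columns D" "only_bottom D c" by blast
    have "\<not> both_rows D z" if "c \<le> z" for z
    proof
      assume "both_rows D z"
      then obtain x where x: "both_rows D x" "c \<le> x" "\<And>y. c \<le> y \<Longrightarrow> y < x \<Longrightarrow> \<not> both_rows D y"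
        using \<open>c \<le> z\<close> by (rule first_both_after) (rule that)
      have cx: "c < x" using x c(2) by (metis le_neq_implies_less only_bottom_iff)
      have run: "only_bottom D y" if "c \<le> y" "y < x" for y
        using that x c(2) both_rows_bounds[of x] by (auto simp: only_bottom_iff)
      obtain s i where "(s, i) \<in> maximal_Ls D" "s + i + 1 = x" "s < c"
        by (rule maximal_L_extends_left[OF x(1) cx run]) (assumption | rule that)+
      then have "c \<in> covered_columns D"
        using cx unfolding covered_columns_iff by (intro exI[of _ s] exI[of _ i]) auto
      then show False using c(1) by simp
    qed
    then show "only_bottom D l" using c(2) by (auto simp: only_bottom_iff)
  next
    assume l: "only_bottom D l"
    have "l \<notin> covered_columns D"
    proof
      assume "l \<in> covered_columns D"
      then obtain s i where "(s, i) \<in> maximal_Ls D" "l \<le> s + i + 1"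
        by (auto simp: covered_columns_iff)
      then have "both_rows D (s + i + 1)" "s + i + 1 = l"
        using both_rows_bounds[of "s + i + 1"] by (auto simp: maximal_Ls_iff)
      then show False using l by (simp add: only_bottom_iff)
    qed
    moreover have "c' < l" if "both_rows D c'" for c'
      using that l both_rows_bounds[of c'] by (metis le_neq_implies_less only_bottom_iff)
    ultimately show ?L using l by blast
  qed
  also have "\<dots> \<longleftrightarrow> ?R"
  proof
    assume l: "only_bottom D l"
    have "\<not> both_rows D x" if "l \<le> x" for x
      using that l both_rows_bounds[of x] by (cases "x = l") (auto simp: only_bottom_iff)
    then have "both_count l = 0" "both_count (Suc l) = 0"
      by (auto simp: both_count_eq_0_iff)
    then have "label_class (n - l) = 1" "label_class (n - l + 1) = 1"
      using l l_le n_ge_2 p_le_l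
      by (auto simp: label_class_def only_bottom_iff Suc_diff_le)
    moreover have "n - l \<in> {1..n}" "n - l + 1 \<in> {1..n}"
      using l l_le n_ge_2 by (auto simp: only_bottom_iff)
    moreover have "n - l \<noteq> n - l + 1" by simp
    ultimately show ?R unfolding nontrivial_classes_def by (metis (mono_tags, lifting) mem_Collect_eq)
  next
    assume ?R
    then obtain x y where xy: "x \<noteq> y" "label_class x = 1" "label_class y = 1"
      by (auto simp: nontrivial_classes_def)
    then have "n - l \<le> x" "n - l \<le> y" by (auto simp: label_class_def split: if_splits)
    with xy obtain j where j: "n - l < j" "label_class j = 1"
      by (metis le_neq_implies_less)
    then have "both_count (n + 1 - j) = 0" "j \<le> n - p"
      by (auto simp: label_class_def split: if_splits)
    then show "only_bottom D l"
      using j l_le p_le_l by (auto simp: both_count_eq_0_iff only_bottom_iff)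
  qed
  finally show ?thesis .
qed

text \<open>A maximal L(i) ending in column \<open>x\<close> is sent to the class of
  \<open>x\<close>. Every class above 1 consists of a two-bullet column and the only-bottom columns
  directly to its left, so it is nontrivial exactly when such a run is present.\<close>

lemma card_maximal_Ls:
  "card (maximal_Ls D) = card (nontrivial_classes {1..n} label_class - {0, 1})"
proof (rule bij_betw_same_card)
  define g where "g = (\<lambda>(s, i). Suc (both_count (s + i + 1)))"
  have "inj_on g (maximal_Ls D)"
  proof (rule inj_onI, clarify)
    fix s i s' i'
    assume a: "(s, i) \<in> maximal_Ls D" "(s', i') \<in> maximal_Ls D" "g (s, i) = g (s', i')"
    then have x: "both_rows D (s + i + 1)" "both_rows D (s' + i' + 1)"
      by (auto simp: maximal_Ls_iff)
    have "both_count (s + i + 1) = both_count (s' + i' + 1)" using a(3) by (simp add: g_def)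
    \<comment> \<open>The count drops just after each two-bullet column, so it determines the end of
      the run; maximality then determines its start.\<close>
    then have "s + i + 1 = s' + i' + 1"
      using x both_count_eq_iff[of "s + i + 1" "s' + i' + 1"]
        both_count_eq_iff[of "s' + i' + 1" "s + i + 1"]
      by (metis linorder_neqE_nat order_le_less order_refl)
    moreover from this have "s = s'"
      using a(1,2) unfolding maximal_Ls_iff
      by (metis add_right_cancel le_add1 linorder_neqE_nat trans_le_add1 less_imp_le add_leD1)
    ultimately show "s = s' \<and> i = i'" by simp
  qed
  moreover have "g ` maximal_Ls D = nontrivial_classes {1..n} label_class - {0, 1}"
  proof (intro equalityI subsetI)
    fix k assume "k \<in> g ` maximal_Ls D"
    then obtain s i where si: "(s, i) \<in> maximal_Ls D" "k = Suc (both_count (s + i + 1))"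
      by (auto simp: g_def)
    then have i: "1 \<le> i" and x: "both_rows D (s + i + 1)" and b: "only_bottom D (s + i)"
      by (auto simp: maximal_Ls_iff)
    have bd: "p < s + i" "s + i + 1 \<le> l"
      using x b both_rows_bounds[of "s + i + 1"] by (auto simp: only_bottom_iff)
    have "both_count (s + i) = both_count (s + i + 1)"
      using both_count_Suc[of "s + i"] b by (simp add: only_bottom_iff)
    \<comment> \<open>These are the labels of columns \<open>s + i + 1\<close> and
      \<open>s + i\<close>, the end of the run and its left neighbour.\<close>
    then have "label_class (n - (s + i)) = k" "label_class (n - (s + i) + 1) = k"
      using bd l_le n_ge_2 si(2) by (auto simp: label_class_def Suc_diff_le)
    moreover have "n - (s + i) \<in> {1..n}" "n - (s + i) + 1 \<in> {1..n}"
      using bd l_le n_ge_2 i by auto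
    moreover have "n - (s + i) \<noteq> n - (s + i) + 1" by simp
    ultimately have "k \<in> nontrivial_classes {1..n} label_class"
      unfolding nontrivial_classes_def by (metis (mono_tags, lifting) mem_Collect_eq)
    moreover have "both_count (s + i + 1) \<noteq> 0"
      using x by (auto simp: both_count_eq_0_iff)
    ultimately show "k \<in> nontrivial_classes {1..n} label_class - {0, 1}" using si(2) by auto
  next
    fix k assume k: "k \<in> nontrivial_classes {1..n} label_class - {0, 1}"
    then obtain x y where "x \<noteq> y" "label_class x = k" "label_class y = k"
      by (auto simp: nontrivial_classes_def)
    then obtain x y where xy: "x < y" "label_class x = k" "label_class y = k"
      by (metis linorder_neqE_nat)
    define c c' where "c = n + 1 - y" and "c' = n + 1 - x"
    have c: "p < c" "c < c'" "Suc (both_count c) = k" "Suc (both_count c') = k"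
      using xy k l_le n_ge_2 p_le_l unfolding c_def c'_def
      by (auto simp: label_class_def split: if_splits)
    have "both_count c \<noteq> 0" using c k by auto
    then obtain z where z: "both_rows D z" "c \<le> z" by (auto simp: both_count_eq_0_iff)
    obtain x where x: "both_rows D x" "c \<le> x" "\<And>y. c \<le> y \<Longrightarrow> y < x \<Longrightarrow> \<not> both_rows D y"
      by (rule first_both_after[OF z]) (rule that)
    \<comment> \<open>A bullet pair in column \<open>c\<close> would make the count at
      \<open>c\<close> exceed the one at \<open>c'\<close>.\<close>
    have "\<not> both_rows D c" using both_count_eq_iff[of c c'] c by auto
    then have cx: "c < x" using x by (metis le_neq_implies_less)
    have run: "only_bottom D y" if "c \<le> y" "y < x" for y
      using that x c both_rows_bounds[of x] by (auto simp: only_bottom_iff)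
    obtain s i where si: "(s, i) \<in> maximal_Ls D" "s + i + 1 = x"
      by (rule maximal_L_extends_left[OF x(1) cx run]) (assumption | rule that)+
    have "both_count c = both_count x" using x by (subst both_count_eq_iff) auto
    then have "g (s, i) = k" using si c by (simp add: g_def)
    then show "k \<in> g ` maximal_Ls D" using si by force
  qed
  ultimately show "bij_betw g (maximal_Ls D) (nontrivial_classes {1..n} label_class - {0, 1})"
    by (simp add: bij_betw_def)
qed

text \<open>The three summands of \<open>tau\<close> count the nontrivial classes other than 0 and
  1, class 0, and class 1.\<close>

lemma tau_eq: "tau D = card (nontrivial_classes {1..n} label_class)"
proof -
  let ?N = "nontrivial_classes {1..n} label_class"
  have "?N \<subseteq> label_class ` {1..n}" by (auto simp: nontrivial_classes_def)
  then have fin: "finite ?N" by (rule finite_subset) simp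
  have "?N = (?N - {0, 1}) \<union> (?N \<inter> {0}) \<union> (?N \<inter> {1})" by auto
  then have "card ?N = card ((?N - {0, 1}) \<union> (?N \<inter> {0}) \<union> (?N \<inter> {1}))" by simp
  also have "\<dots> = card (?N - {0, 1}) + card (?N \<inter> {0}) + card (?N \<inter> {1})"
    using fin by (subst card_Un_disjoint; auto)+
  also have "card (?N \<inter> {0}) = (if 0 \<in> ?N then 1 else 0)" by simp
  also have "card (?N \<inter> {1}) = (if 1 \<in> ?N then 1 else 0)" by simp
  finally show ?thesis
    unfolding tau_def uncovered_only_top_iff uncovered_only_bottom_iff card_maximal_Ls by simp
qed


section \<open>The arcs of the network\<close>

abbreviation src2 :: nat where "src2 \<equiv> n - l"

lemma source_labels: "source_label 2 n D 1 = 1" "source_label 2 n D 2 = src2"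
proof -
  have "{c. (1, c) \<in> boxes D} = {1..n - 2}" "{c. (2, c) \<in> boxes D} = {1..l}"
    by (auto simp: boxes)
  then show "source_label 2 n D 1 = 1" "source_label 2 n D 2 = src2"
    using n_ge_2 l_le by (simp_all add: source_label_def)
qed

lemma sources_eq: "sources 2 n D = {1, src2}"
proof -
  have "{1..2} = {1, 2::nat}" by auto
  then show ?thesis unfolding sources_def by (simp only: image_insert image_empty source_labels)
qed

lemma sink_label_eq:
  assumes "1 \<le> c" "c \<le> n - 2"
  shows "sink_label 2 n D c = (if c \<le> l then n + 1 - c else n - c)"
proof -
  have "{r. (r, c) \<in> boxes D} = (if c \<le> l then {1, 2} else {1})"
    using assms by (auto simp: boxes)
  then show ?thesis using assms by (auto simp: sink_label_def)
qed

lemma inj_sink_label: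
  "1 \<le> c \<Longrightarrow> c \<le> n - 2 \<Longrightarrow> 1 \<le> c' \<Longrightarrow> c' \<le> n - 2 \<Longrightarrow>
     sink_label 2 n D c = sink_label 2 n D c' \<Longrightarrow> c = c'"
  by (simp add: sink_label_eq split: if_splits)

lemma sink_label_not_source:
  "1 \<le> c \<Longrightarrow> c \<le> n - 2 \<Longrightarrow> sink_label 2 n D c \<in> {1..n} - {1, src2}"
  using l_le by (auto simp: sink_label_eq)

lemma column_range: "(r, c) \<in> bullets D \<Longrightarrow> 1 \<le> c \<and> c \<le> n - 2"
  and row_range: "(r, c) \<in> bullets D \<Longrightarrow> r = 1 \<or> r = 2"
  using bullets_rows by auto

text \<open>The bottom bullets fill a block without gaps, so arcs in row 2 join neighbouring
  columns, whereas arcs in row 1 may skip columns.\<close>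

lemma horizontal_arcs_cases:
  assumes "e \<in> horizontal_arcs 2 n D"
  obtains c where "(1, c) \<in> bullets D" "\<And>x. c < x \<Longrightarrow> (1, x) \<notin> bullets D"
      "e = (Boundary 1, Internal 1 c)"
    | c c' where "(1, c) \<in> bullets D" "(1, c') \<in> bullets D" "c' < c"
      "\<And>x. c' < x \<Longrightarrow> x < c \<Longrightarrow> (1, x) \<notin> bullets D" "e = (Internal 1 c, Internal 1 c')"
    | "p < l" "e = (Boundary src2, Internal 2 l)"
    | c where "p < c" "c < l" "e = (Internal 2 (Suc c), Internal 2 c)"
proof -
  note first = that(1) and top = that(2) and second = that(3) and bottom = that(4)
  consider
    (source) r c where "r \<in> {1..2}" "(r, c) \<in> bullets D" "\<And>x. c < x \<Longrightarrow> (r, x) \<notin> bullets D"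
      "e = (Boundary (source_label 2 n D r), Internal r c)"
  | (inner) r c c' where "(r, c) \<in> bullets D" "(r, c') \<in> bullets D" "c' < c"
      "\<And>x. c' < x \<Longrightarrow> x < c \<Longrightarrow> (r, x) \<notin> bullets D" "e = (Internal r c, Internal r c')"
    using assms unfolding horizontal_arcs_def by blast
  then show ?thesis
  proof cases
    case source
    show ?thesis
    proof (cases "r = 1")
      case True
      then show ?thesis using source first[of c] source_labels(1) by blast
    next
      case False
      then have r: "r = 2" using source(1) by auto
      have "c = l" using source(2) source(3)[of l] r
        by (cases "c < l") (auto simp: bullets_bottom)
      then show ?thesis using source(2,4) second source_labels(2) unfolding r by (simp add: bullets_bottom)
    qed
  next
    case inner
    show ?thesis
    proof (cases "r = 1")
      case True
      then show ?thesis using inner top[of c c'] by simp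
    next
      case False
      then have r: "r = 2" using inner(1) row_range by blast
      have "c = Suc c'"
        using inner(1-3) inner(4)[of "Suc c'"] r by (cases "Suc c' < c") (auto simp: bullets_bottom)
      then show ?thesis using inner r bottom[of c'] by (simp add: bullets_bottom)
    qed
  qed
qed

lemma vertical_arcs_cases:
  assumes "e \<in> vertical_arcs 2 n D"
  obtains c where "both_rows D c" "e = (Internal 1 c, Internal 2 c)"
    | c where "only_top D c" "e = (Internal 1 c, Boundary (sink_label 2 n D c))"
    | c where "p < c" "c \<le> l" "e = (Internal 2 c, Boundary (sink_label 2 n D c))"
proof -
  note both = that(1) and top = that(2) and bottom = that(3)
  consider
    (inner) r r' c where "(r, c) \<in> bullets D" "(r', c) \<in> bullets D" "r < r'"
      "e = (Internal r c, Internal r' c)"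
  | (sink) r c where "(r, c) \<in> bullets D" "\<And>x. r < x \<Longrightarrow> (x, c) \<notin> bullets D"
      "e = (Internal r c, Boundary (sink_label 2 n D c))"
    using assms unfolding vertical_arcs_def by blast
  then show ?thesis
  proof cases
    case inner
    then have "r = 1" "r' = 2" using row_range[of r c] row_range[of r' c] by auto
    then show ?thesis using inner both[of c] by (simp add: both_rows_def)
  next
    case sink
    show ?thesis
    proof (cases "r = 1")
      case True
      then show ?thesis using sink top[of c] by (simp add: only_top_def)
    next
      case False
      then have "r = 2" using sink(1) row_range by blast
      then show ?thesis using sink bottom[of c] by (simp add: bullets_bottom)
    qed
  qed
qed

lemma source_top_arc:
  "(1, c) \<in> bullets D \<Longrightarrow> (\<And>x. c < x \<Longrightarrow> (1, x) \<notin> bullets D) \<Longrightarrow>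
     (Boundary 1, Internal 1 c) \<in> horizontal_arcs 2 n D"
  unfolding horizontal_arcs_def using source_labels(1) by force

lemma top_arc:
  "(1, c) \<in> bullets D \<Longrightarrow> (1, c') \<in> bullets D \<Longrightarrow> c' < c \<Longrightarrow>
     (\<And>x. c' < x \<Longrightarrow> x < c \<Longrightarrow> (1, x) \<notin> bullets D) \<Longrightarrow>
     (Internal 1 c, Internal 1 c') \<in> horizontal_arcs 2 n D"
  unfolding horizontal_arcs_def by blast

text \<open>Column \<open>l + 1\<close> stands for the second source, so that the source and the
  bottom row form one chain with a uniform recursion.\<close>

definition bottom_vertex :: "nat \<Rightarrow> vertex" where
  "bottom_vertex c = (if c = Suc l then Boundary src2 else Internal 2 c)"

lemma bottom_arc:
  assumes "p < c" "c \<le> l"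
  shows "(bottom_vertex (Suc c), Internal 2 c) \<in> horizontal_arcs 2 n D"
proof (cases "c = l")
  case True
  have "(2, l) \<in> bullets D \<and> (\<forall>x. l < x \<longrightarrow> (2, x) \<notin> bullets D)"
    using assms by (auto simp: bullets_bottom)
  then show ?thesis
    using True source_labels(2) unfolding horizontal_arcs_def bottom_vertex_def by force
next
  case False
  then have "(2, Suc c) \<in> bullets D" "(2, c) \<in> bullets D"
    using assms by (auto simp: bullets_bottom)
  then show ?thesis
    using False unfolding horizontal_arcs_def bottom_vertex_def by auto
qed

lemma both_arc: "both_rows D c \<Longrightarrow> (Internal 1 c, Internal 2 c) \<in> vertical_arcs 2 n D"
  unfolding vertical_arcs_def both_rows_def by force

lemma top_sink_arc:
  assumes "only_top D c"
  shows "(Internal 1 c, Boundary (sink_label 2 n D c)) \<in> vertical_arcs 2 n D"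
proof -
  have "(1, c) \<in> bullets D \<and> (\<forall>x. 1 < x \<longrightarrow> (x, c) \<notin> bullets D)"
    using assms row_range by (force simp: only_top_def)
  then show ?thesis unfolding vertical_arcs_def by blast
qed

lemma bottom_sink_arc:
  assumes "p < c" "c \<le> l"
  shows "(Internal 2 c, Boundary (sink_label 2 n D c)) \<in> vertical_arcs 2 n D"
proof -
  have "(2, c) \<in> bullets D \<and> (\<forall>x. 2 < x \<longrightarrow> (x, c) \<notin> bullets D)"
    using assms row_range by (force simp: bullets_bottom)
  then show ?thesis unfolding vertical_arcs_def by blast
qed

lemma only_top_range: "only_top D c \<Longrightarrow> 1 \<le> c \<and> c \<le> n - 2"
  by (auto simp: only_top_iff)

section \<open>The network as a finite acyclic digraph\<close>

abbreviation net :: "(vertex, vertex \<times> vertex) pre_digraph" where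
  "net \<equiv> network 2 n D"

lemma arcs_net: "arcs net = horizontal_arcs 2 n D \<union> vertical_arcs 2 n D"
  and tail_net: "tail net = fst" and head_net: "head net = snd"
  by (simp_all add: network_def)

lemma Boundary_in_verts: "1 \<le> i \<Longrightarrow> i \<le> n \<Longrightarrow> Boundary i \<in> verts net"
  by (simp add: network_def)

lemma Internal_in_verts: "(r, c) \<in> bullets D \<Longrightarrow> Internal r c \<in> verts net"
  by (force simp: network_def)

lemma arc_ends_in_verts:
  assumes "e \<in> arcs net"
  shows "fst e \<in> verts net \<and> snd e \<in> verts net"
proof -
  have src2: "1 \<le> src2" "src2 \<le> n" using l_le n_ge_2 by auto
  have sink: "Boundary (sink_label 2 n D c) \<in> verts net" if "1 \<le> c" "c \<le> n - 2" for c
    using sink_label_not_source[OF that] by (auto intro: Boundary_in_verts)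
  have b: "1 \<le> c \<and> c \<le> n - 2" if "p < c" "c \<le> l" for c using that l_le by auto
  from assms consider "e \<in> horizontal_arcs 2 n D" | "e \<in> vertical_arcs 2 n D"
    by (auto simp: arcs_net)
  then show ?thesis
  proof cases
    case 1
    then show ?thesis
      by (cases rule: horizontal_arcs_cases)
        (use src2 n_ge_2 in \<open>auto simp: bullets_bottom intro: Boundary_in_verts Internal_in_verts\<close>)
  next
    case 2
    then show ?thesis
      by (cases rule: vertical_arcs_cases)
        (use sink b only_top_range in \<open>auto simp: bullets_bottom both_rows_def only_top_def
          intro: Internal_in_verts\<close>)
  qed
qed

sublocale net: fin_digraph net
proof
  show "finite (verts net)"
    using finite_subset[OF bullets_rows] by (simp add: network_def)
  then have "finite (verts net \<times> verts net)" by simp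
  moreover have "arcs net \<subseteq> verts net \<times> verts net"
    using arc_ends_in_verts by (auto simp: mem_Times_iff)
  ultimately show "finite (arcs net)" by (rule rev_finite_subset)
qed (use arc_ends_in_verts in \<open>auto simp: tail_net head_net\<close>)

text \<open>A rank function witnessing acyclicity: it grows leftward and downward. Internal columns
  lie between 1 and \<open>n - 2\<close>, which puts internal values strictly between 0 at the
  sources and \<open>3 * n\<close> at the sinks.\<close>

fun depth :: "vertex \<Rightarrow> nat" where
  "depth (Boundary i) = (if i = 1 \<or> i = src2 then 0 else 3 * n)"
| "depth (Internal r c) = 3 * (n - c) + r - 3"

lemma depth_increases:
  assumes "e \<in> arcs net"
  shows "depth (tail net e) < depth (head net e)"
proof -
  from assms consider "e \<in> horizontal_arcs 2 n D" | "e \<in> vertical_arcs 2 n D"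
    by (auto simp: arcs_net)
  then show ?thesis
  proof cases
    case 1
    then show ?thesis
    proof (cases rule: horizontal_arcs_cases)
      case (1 c)
      then show ?thesis using column_range[of 1 c] n_ge_2 by (auto simp: tail_net head_net)
    next
      case (2 c c')
      then show ?thesis using column_range[of 1 c] n_ge_2 by (auto simp: tail_net head_net)
    next
      case 3
      then show ?thesis using l_le n_ge_2 by (auto simp: tail_net head_net)
    next
      case (4 c)
      then show ?thesis using l_le n_ge_2 by (auto simp: tail_net head_net)
    qed
  next
    case 2
    then show ?thesis
    proof (cases rule: vertical_arcs_cases)
      case (1 c)
      then show ?thesis using both_rows_bounds[of c] l_le n_ge_2 by (auto simp: tail_net head_net)
    next
      case (2 c)
      then show ?thesis using only_top_range[of c] sink_label_not_source[of c] n_ge_2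
        by (auto simp: tail_net head_net)
    next
      case (3 c)
      then show ?thesis using sink_label_not_source[of c] l_le n_ge_2
        by (auto simp: tail_net head_net)
    qed
  qed
qed

section \<open>The arcs entering each vertex\<close>

lemma in_arcs_source:
  assumes "s \<in> {1, src2}"
  shows "{e \<in> arcs net. head net e = Boundary s} = {}"
proof -
  \<comment> \<open>Sources have depth 0, while the head of an arc has positive depth.\<close>
  have "head net e \<noteq> Boundary s" if "e \<in> arcs net" for e
    using depth_increases[OF that] assms by (cases "head net e") auto
  then show ?thesis by blast
qed

lemma arc_to_topE:
  assumes "e \<in> arcs net" "head net e = Internal 1 c'"
  shows "(\<forall>x>c'. (1, x) \<notin> bullets D) \<and> e = (Boundary 1, Internal 1 c') \<or>
    (\<exists>c>c'. (1, c) \<in> bullets D \<and> (\<forall>x. c' < x \<and> x < c \<longrightarrow> (1, x) \<notin> bullets D) \<and>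
      e = (Internal 1 c, Internal 1 c'))"
proof -
  have "e \<notin> vertical_arcs 2 n D"
    using assms(2) by (auto simp: head_net elim: vertical_arcs_cases)
  then have "e \<in> horizontal_arcs 2 n D" using assms(1) by (simp add: arcs_net)
  then show ?thesis
  proof (cases rule: horizontal_arcs_cases)
    case (1 c)
    then show ?thesis using assms(2) by (simp add: head_net)
  next
    case (2 c d)
    then have "d = c'" using assms(2) by (simp add: head_net)
    then show ?thesis using 2 by blast
  qed (use assms(2) in \<open>simp_all add: head_net\<close>)
qed

lemma in_arcs_top_source:
  assumes "(1, c) \<in> bullets D" "\<And>x. c < x \<Longrightarrow> (1, x) \<notin> bullets D"
  shows "{e \<in> arcs net. head net e = Internal 1 c} = {(Boundary 1, Internal 1 c)}"
proof -
  have "e = (Boundary 1, Internal 1 c)" if "e \<in> arcs net" "head net e = Internal 1 c" for e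
    using arc_to_topE[OF that] assms by blast
  then show ?thesis using source_top_arc[OF assms] by (auto simp: arcs_net head_net)
qed

lemma in_arcs_top:
  assumes "(1, c) \<in> bullets D" "(1, c') \<in> bullets D" "c' < c"
    "\<And>x. c' < x \<Longrightarrow> x < c \<Longrightarrow> (1, x) \<notin> bullets D"
  shows "{e \<in> arcs net. head net e = Internal 1 c'} = {(Internal 1 c, Internal 1 c')}"
proof -
  have "e = (Internal 1 c, Internal 1 c')" if "e \<in> arcs net" "head net e = Internal 1 c'" for e
    using arc_to_topE[OF that]
  proof (elim disjE exE conjE)
    fix d
    assume d: "c' < d" "(1, d) \<in> bullets D" "\<forall>x. c' < x \<and> x < d \<longrightarrow> (1, x) \<notin> bullets D"
      "e = (Internal 1 d, Internal 1 c')"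
    have "d = c" using d(1-3) assms by (cases d c rule: linorder_cases) auto
    then show ?thesis using d by simp
  qed (use assms in blast)
  then show ?thesis using top_arc[OF assms] by (auto simp: arcs_net head_net)
qed

lemma arc_to_bottomE:
  assumes "e \<in> arcs net" "head net e = Internal 2 c"
  shows "e = (bottom_vertex (Suc c), Internal 2 c) \<or>
    both_rows D c \<and> e = (Internal 1 c, Internal 2 c)"
proof -
  from assms(1) consider "e \<in> horizontal_arcs 2 n D" | "e \<in> vertical_arcs 2 n D"
    by (auto simp: arcs_net)
  then show ?thesis
  proof cases
    case 1
    then show ?thesis
      unfolding bottom_vertex_def
      by (cases rule: horizontal_arcs_cases) (use assms(2) in \<open>simp_all add: head_net\<close>)
  next
    case 2
    then show ?thesis
      by (cases rule: vertical_arcs_cases) (use assms(2) in \<open>simp_all add: head_net\<close>)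
  qed
qed

lemma in_arcs_bottom:
  assumes "p < c" "c \<le> l"
  shows "{e \<in> arcs net. head net e = Internal 2 c} =
    insert (bottom_vertex (Suc c), Internal 2 c)
      (if both_rows D c then {(Internal 1 c, Internal 2 c)} else {})" (is "_ = ?A")
proof -
  have "e \<in> ?A" if "e \<in> arcs net" "head net e = Internal 2 c" for e
    using arc_to_bottomE[OF that] by auto
  moreover have "e \<in> arcs net \<and> head net e = Internal 2 c" if "e \<in> ?A" for e
    using that bottom_arc[OF assms] both_arc[of c]
    by (auto simp: arcs_net head_net split: if_splits)
  ultimately show ?thesis by blast
qed

lemma arc_to_sinkE:
  assumes "e \<in> arcs net" "head net e = Boundary (sink_label 2 n D c)" "1 \<le> c" "c \<le> n - 2"
  shows "only_top D c \<and> e = (Internal 1 c, Boundary (sink_label 2 n D c)) \<or>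
    p < c \<and> c \<le> l \<and> e = (Internal 2 c, Boundary (sink_label 2 n D c))"
proof -
  have "e \<notin> horizontal_arcs 2 n D"
    using assms(2) by (auto simp: head_net elim: horizontal_arcs_cases)
  then have "e \<in> vertical_arcs 2 n D" using assms(1) by (simp add: arcs_net)
  then show ?thesis
  proof (cases rule: vertical_arcs_cases)
    case (1 c')
    then show ?thesis using assms(2) by (simp add: head_net)
  next
    case (2 c')
    then have "c' = c"
      using assms(2-) only_top_range inj_sink_label[of c' c] by (simp add: head_net)
    then show ?thesis using 2 by simp
  next
    case (3 c')
    then have "c' = c"
      using assms(2-) l_le inj_sink_label[of c' c] by (simp add: head_net)
    then show ?thesis using 3 by simp
  qed
qed

lemma in_arcs_top_sink:
  assumes "only_top D c"
  shows "{e \<in> arcs net. head net e = Boundary (sink_label 2 n D c)} =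
    {(Internal 1 c, Boundary (sink_label 2 n D c))}"
proof -
  have "e = (Internal 1 c, Boundary (sink_label 2 n D c))"
    if "e \<in> arcs net" "head net e = Boundary (sink_label 2 n D c)" for e
    using arc_to_sinkE[OF that] only_top_range[OF assms] assms by (auto simp: only_top_iff)
  then show ?thesis using top_sink_arc[OF assms] by (auto simp: arcs_net head_net)
qed

lemma in_arcs_bottom_sink:
  assumes "p < c" "c \<le> l"
  shows "{e \<in> arcs net. head net e = Boundary (sink_label 2 n D c)} =
    {(Internal 2 c, Boundary (sink_label 2 n D c))}"
proof -
  have "e = (Internal 2 c, Boundary (sink_label 2 n D c))"
    if "e \<in> arcs net" "head net e = Boundary (sink_label 2 n D c)" for e
    using arc_to_sinkE[OF that] assms l_le by (auto simp: only_top_iff)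
  then show ?thesis using bottom_sink_arc[OF assms] by (auto simp: arcs_net head_net)
qed

end

section \<open>The maximal minors\<close>

locale weighted_two_row_diagram = two_row_diagram +
  fixes w :: "vertex \<times> vertex \<Rightarrow> real"
  assumes weights: "network_weights 2 n D w"
begin

section \<open>Path sums from the two sources\<close>

abbreviation W :: "nat \<Rightarrow> vertex \<Rightarrow> real" where
  "W s \<equiv> path_sum net w (Boundary s)"

lemma weight_pos: "e \<in> horizontal_arcs 2 n D \<Longrightarrow> 0 < w e"
  and weight_one: "e \<in> vertical_arcs 2 n D \<Longrightarrow> w e = 1"
  using weights by (auto simp: network_weights_def)

lemma W_last_arc:
  "Boundary s \<noteq> v \<Longrightarrow> W s v = (\<Sum>e | e \<in> arcs net \<and> head net e = v. W s (fst e) * w e)"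
  using net.path_sum_last_arc[OF depth_increases, of "Boundary s" v w] by (simp add: tail_net)

lemma src2_ge_2: "2 \<le> src2" and src2_le: "src2 \<le> n"
  using l_le n_ge_2 by auto

lemma W_source:
  assumes "s \<in> {1, src2}" "s' \<in> {1, src2}"
  shows "W s (Boundary s') = (if s = s' then 1 else 0)"
proof (cases "s = s'")
  case True
  have "Boundary s \<in> verts net"
    using assms(1) src2_ge_2 src2_le n_ge_2 by (intro Boundary_in_verts) auto
  then show ?thesis using True net.path_sum_refl by simp
next
  case False
  then show ?thesis
    using W_last_arc[of s "Boundary s'"] in_arcs_source[OF assms(2)] by simp
qed

text \<open>Each top-row vertex has a single incoming arc, from the right in its own row; positivity
  spreads leftward from the first source, and the second source never reaches this row.\<close>

lemma W_top:
  assumes "(1, c) \<in> bullets D"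
  shows "0 < W 1 (Internal 1 c) \<and> W src2 (Internal 1 c) = 0"
  using assms
proof (induction "n - c" arbitrary: c rule: less_induct)
  case less
  show ?case
  proof (cases "\<exists>x>c. (1, x) \<in> bullets D")
    case False
    then have no: "\<And>x. c < x \<Longrightarrow> (1, x) \<notin> bullets D" by blast
    show ?thesis
      using W_last_arc[of _ "Internal 1 c"] in_arcs_top_source[OF less.prems no]
        weight_pos[OF source_top_arc[OF less.prems no]] W_source[of 1 1] W_source[of src2 1] src2_ge_2
      by simp
  next
    case True
    then obtain z where z: "c < z \<and> (1, z) \<in> bullets D" by blast
    \<comment> \<open>The nearest top bullet to the right of \<open>c\<close>, where the unique arc
      into \<open>Internal 1 c\<close> starts.\<close>
    define d where "d = (LEAST x. c < x \<and> (1, x) \<in> bullets D)"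
    have d: "c < d" "(1, d) \<in> bullets D"
      using LeastI[of "\<lambda>x. c < x \<and> (1, x) \<in> bullets D", OF z] by (simp_all add: d_def)
    have no: "(1, x) \<notin> bullets D" if "c < x" "x < d" for x
      using not_less_Least[of x "\<lambda>x. c < x \<and> (1, x) \<in> bullets D"] that unfolding d_def by blast
    have "n - d < n - c" using d column_range[of 1 d] by auto
    then have IH: "0 < W 1 (Internal 1 d) \<and> W src2 (Internal 1 d) = 0"
      using less.hyps d by blast
    have "W s (Internal 1 c) = W s (Internal 1 d) * w (Internal 1 d, Internal 1 c)" for s
      using W_last_arc[of s "Internal 1 c"] in_arcs_top[OF d(2) less.prems d(1) no] by simp
    then show ?thesis using IH weight_pos[OF top_arc[OF d(2) less.prems d(1) no]] by simp
  qed
qed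

lemma W_bottom_step:
  assumes "p < c" "c \<le> l"
  shows "W s (bottom_vertex c) =
    W s (bottom_vertex (Suc c)) * w (bottom_vertex (Suc c), bottom_vertex c) +
      (if both_rows D c then W s (Internal 1 c) else 0)"
proof -
  have v: "bottom_vertex c = Internal 2 c" using assms by (simp add: bottom_vertex_def)
  \<comment> \<open>The horizontal and the vertical arc into the vertex are distinct, so the sum
    over incoming arcs has two separate terms.\<close>
  have "bottom_vertex (Suc c) \<noteq> Internal 1 c" by (simp add: bottom_vertex_def)
  then show ?thesis
    using W_last_arc[of s "Internal 2 c"] in_arcs_bottom[OF assms] weight_one[OF both_arc[of c]]
    unfolding v by (auto split: if_splits)
qed

lemma bottom_weight_pos:
  "p < c \<Longrightarrow> c \<le> l \<Longrightarrow> 0 < w (bottom_vertex (Suc c), bottom_vertex c)"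
  using weight_pos[OF bottom_arc[of c]] by (simp add: bottom_vertex_def)

lemma W_src2_bottom_pos: "p < c \<Longrightarrow> c \<le> Suc l \<Longrightarrow> 0 < W src2 (bottom_vertex c)"
proof (induction "Suc l - c" arbitrary: c)
  case 0
  then have "c = Suc l" by simp
  then show ?case using W_source[of src2 src2] by (simp add: bottom_vertex_def)
next
  case (Suc k)
  then have "0 < W src2 (bottom_vertex (Suc c))" "c \<le> l" by auto
  moreover have "both_rows D c \<Longrightarrow> W src2 (Internal 1 c) = 0"
    using W_top by (simp add: both_rows_def)
  ultimately show ?case
    using W_bottom_step[of c src2] bottom_weight_pos[of c] Suc.prems by simp
qed

text \<open>Up to sign, the ratio of the two matrix entries belonging to a bottom vertex; two such
  vectors are parallel exactly when their slopes agree.\<close>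

definition slope :: "nat \<Rightarrow> real" where
  "slope c = W 1 (bottom_vertex c) / W src2 (bottom_vertex c)"

text \<open>The weight of the horizontal arc multiplies both path sums and cancels. The vertical arc
  of a two-bullet column adds a positive term to the numerator only, as the second source does not
  reach the top row.\<close>

lemma slope_step:
  assumes "p < c" "c \<le> l"
  shows "if both_rows D c then slope (Suc c) < slope c else slope c = slope (Suc c)"
proof -
  let ?h = "w (bottom_vertex (Suc c), bottom_vertex c)"
  have h: "0 < ?h" using bottom_weight_pos assms .
  have pos: "0 < W src2 (bottom_vertex (Suc c))" using W_src2_bottom_pos[of "Suc c"] assms by simp
  have den: "W src2 (bottom_vertex c) = W src2 (bottom_vertex (Suc c)) * ?h"
    using W_bottom_step[OF assms, of src2] W_top[of c] by (simp add: both_rows_def)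
  have num: "W 1 (bottom_vertex c) = W 1 (bottom_vertex (Suc c)) * ?h +
      (if both_rows D c then W 1 (Internal 1 c) else 0)"
    using W_bottom_step[OF assms] .
  have "slope c = slope (Suc c) +
      (if both_rows D c then W 1 (Internal 1 c) else 0) / (W src2 (bottom_vertex (Suc c)) * ?h)"
    unfolding slope_def num den using h pos by (simp add: field_simps)
  moreover have "both_rows D c \<Longrightarrow> 0 < W 1 (Internal 1 c)"
    using W_top by (simp add: both_rows_def)
  ultimately show ?thesis using h pos by simp
qed

text \<open>Slope and count jump at the same columns and always in the same direction. The
  inequality is carried through the induction so that jumps cannot cancel.\<close>

lemma slope_eq_iff:
  assumes "p < c" "c \<le> c'" "c' \<le> Suc l"
  shows "slope c' \<le> slope c \<and> (slope c = slope c' \<longleftrightarrow> both_count c = both_count c')"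
  using assms(2,1)
proof (induction rule: inc_induct)
  case (step m)
  then show ?case
    using slope_step[of m] both_count_Suc[of m] both_count_antimono[of "Suc m" c'] assms(3)
    by (auto split: if_splits)
qed simp

section \<open>Matrix entries and maximal minors\<close>

lemma meas_eq:
  "meas 2 n D w i j =
     (- 1) ^ card {s \<in> {1, src2}. min i j < s \<and> s < max i j} * W i (Boundary j)"
  unfolding meas_def path_sum_def sources_eq by (simp add: sum_distrib_left)

lemma meas_1:
  assumes "1 \<le> j"
  shows "meas 2 n D w 1 j = (if src2 < j then - W 1 (Boundary j) else W 1 (Boundary j))"
proof -
  \<comment> \<open>Source 1 is an endpoint, so only the second source can lie strictly
    between.\<close>
  have "{s \<in> {1, src2}. min 1 j < s \<and> s < max 1 j} = (if src2 < j then {src2} else {})"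
    using assms src2_ge_2 by (auto simp: min_def max_def)
  then show ?thesis by (simp add: meas_eq)
qed

lemma meas_src2:
  assumes "1 \<le> j"
  shows "meas 2 n D w src2 j = W src2 (Boundary j)"
proof -
  have "{s \<in> {1, src2}. min src2 j < s \<and> s < max src2 j} = {}"
    using assms src2_ge_2 by (auto simp: min_def max_def)
  then show ?thesis unfolding meas_eq by (simp only: card.empty power_0 mult_1)
qed

lemma W_label_top:
  assumes "j \<in> {1..n}" "label_class j = 0"
  shows "0 < W 1 (Boundary j) \<and> W src2 (Boundary j) = 0"
proof (cases "j = 1")
  case True
  then show ?thesis using W_source[of 1 1] W_source[of src2 1] src2_ge_2 by simp
next
  case False
  define c where "c = (if n - p < j then n + 1 - j else n - j)"
  have j: "j < src2 \<or> n - p < j" using assms(2) by (auto simp: label_class_def split: if_splits)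
  have c: "only_top D c" and jc: "j = sink_label 2 n D c"
    using False j assms(1) l_le p_le_l n_ge_2
    by (auto simp: c_def only_top_iff sink_label_eq split: if_splits)
  have "j \<notin> {1, src2}" using sink_label_not_source[of c] only_top_range[OF c] jc by simp
  then have "W s (Boundary j) = W s (Internal 1 c)" if "s \<in> {1, src2}" for s
    using that W_last_arc[of s "Boundary j"] in_arcs_top_sink[OF c, folded jc]
      weight_one[OF top_sink_arc[OF c, folded jc]] by auto
  then show ?thesis using W_top[of c] c by (simp add: only_top_def)
qed

text \<open>A bottom sink has one incoming arc, of weight 1, from its bottom vertex. For the second
  source, \<open>n + 1 - j\<close> equals \<open>Suc l\<close>, where \<open>bottom_vertex\<close>
  is that source itself.\<close>

lemma W_label_bottom:
  assumes "j \<in> {1..n}" "label_class j \<noteq> 0" "s \<in> {1, src2}"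
  shows "W s (Boundary j) = W s (bottom_vertex (n + 1 - j))"
proof (cases "j = src2")
  case True
  then have "n + 1 - j = Suc l" using l_le n_ge_2 by simp
  then show ?thesis using True by (simp add: bottom_vertex_def)
next
  case False
  define c where "c = n + 1 - j"
  have "src2 \<le> j" "j \<le> n - p" using assms(2) by (auto simp: label_class_def split: if_splits)
  then have c: "p < c" "c \<le> l" and jc: "j = sink_label 2 n D c"
    using False assms(1) l_le p_le_l n_ge_2 by (auto simp: c_def sink_label_eq)
  have "j \<notin> {1, src2}" using sink_label_not_source[of c] c l_le jc by simp
  then have "W s (Boundary j) = W s (Internal 2 c)"
    using assms(3) W_last_arc[of s "Boundary j"] in_arcs_bottom_sink[OF c, folded jc]
      weight_one[OF bottom_sink_arc[OF c, folded jc]] by auto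
  then show ?thesis using c unfolding c_def[symmetric] by (simp add: bottom_vertex_def)
qed

lemma W_1_src2: "W 1 (Boundary src2) = 0"
  using W_source[of 1 src2] src2_ge_2 by simp

text \<open>Labels of class 0 have a nonzero first and a zero second entry. All others have a
  positive second entry \<open>b\<close> and first entry \<open>- slope * b\<close>, so a minor of
  two of them is a difference of slopes times a positive number.\<close>

lemma minor_nonzero_iff:
  assumes "x \<in> {1..n}" "y \<in> {1..n}"
  shows "meas 2 n D w 1 x * meas 2 n D w src2 y - meas 2 n D w 1 y * meas 2 n D w src2 x \<noteq> 0 \<longleftrightarrow>
    label_class x \<noteq> label_class y"
proof -
  let ?a = "meas 2 n D w 1" and ?b = "meas 2 n D w src2"
  have top: "?a j \<noteq> 0 \<and> ?b j = 0" if "j \<in> {1..n}" "label_class j = 0" for j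
    using that(1) W_label_top[OF that] meas_1[of j] meas_src2[of j] by (auto split: if_splits)
  have bottom: "0 < ?b j \<and> ?a j = - slope (n + 1 - j) * ?b j \<and>
      p < n + 1 - j \<and> n + 1 - j \<le> Suc l \<and> label_class j = Suc (both_count (n + 1 - j))"
    if j: "j \<in> {1..n}" "label_class j \<noteq> 0" for j
  proof -
    have r: "src2 \<le> j" "j \<le> n - p" using j(2) by (auto simp: label_class_def split: if_splits)
    then have c: "p < n + 1 - j" "n + 1 - j \<le> Suc l" using j(1) l_le by auto
    have pos: "0 < W src2 (bottom_vertex (n + 1 - j))" using W_src2_bottom_pos c by blast
    \<comment> \<open>At \<open>j = src2\<close> the sign rule gives no minus sign, but the entry is
      0.\<close>
    have "?a j = - W 1 (Boundary j)"
      using j(1) r W_1_src2 meas_1[of j] by (cases "j = src2") auto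
    then have "?a j = - slope (n + 1 - j) * ?b j"
      using j pos W_label_bottom[OF j] by (simp add: slope_def meas_src2)
    then show ?thesis using c pos r j W_label_bottom[OF j] by (simp add: meas_src2 label_class_def)
  qed
  consider "label_class x = 0" "label_class y = 0" | "label_class x = 0" "label_class y \<noteq> 0"
    | "label_class x \<noteq> 0" "label_class y = 0" | "label_class x \<noteq> 0" "label_class y \<noteq> 0"
    by blast
  then show ?thesis
  proof cases
    case 4
    let ?c = "n + 1 - x" and ?d = "n + 1 - y"
    have bx: "0 < ?b x" "?a x = - slope ?c * ?b x" "p < ?c" "?c \<le> Suc l"
        "label_class x = Suc (both_count ?c)"
      and "by": "0 < ?b y" "?a y = - slope ?d * ?b y" "p < ?d" "?d \<le> Suc l"
        "label_class y = Suc (both_count ?d)"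
      using bottom[OF assms(1) 4(1)] bottom[OF assms(2) 4(2)] by auto
    have "?a x * ?b y - ?a y * ?b x = (slope ?d - slope ?c) * (?b x * ?b y)"
      unfolding bx(2) "by"(2) by (simp add: algebra_simps)
    then have "?a x * ?b y - ?a y * ?b x \<noteq> 0 \<longleftrightarrow> slope ?d \<noteq> slope ?c"
      using bx(1) "by"(1) by simp
    also have "\<dots> \<longleftrightarrow> both_count ?c \<noteq> both_count ?d"
      using slope_eq_iff[of ?c ?d] slope_eq_iff[of ?d ?c] bx(3,4) "by"(3,4)
      by (metis linear)
    finally show ?thesis unfolding bx(5) "by"(5) by simp
  qed (use top[OF assms(1)] top[OF assms(2)] bottom[OF assms(1)] bottom[OF assms(2)] in auto)
qed

lemma maximal_minor_eq:
  assumes "x < y"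
  shows "maximal_minor 2 n D w {x, y} =
    meas 2 n D w 1 x * meas 2 n D w src2 y - meas 2 n D w 1 y * meas 2 n D w src2 x"
proof -
  have s: "sorted_list_of_set {x, y} = [x, y]" if "x < y" for x y :: nat
    using that sorted_list_of_set.idem_if_sorted_distinct[of "[x, y]"] by simp
  have "1 < src2" using src2_ge_2 by simp
  then show ?thesis
    unfolding maximal_minor_def det_mat_2 sources_eq by (simp add: s[OF assms] s[of 1 src2])
qed

lemma positroid_bases_eq:
  "positroid_bases 2 n D w = class_bases {1..n} label_class"
proof -
  have *: "{x, y} \<in> positroid_bases 2 n D w \<longleftrightarrow> {x, y} \<in> class_bases {1..n} label_class"
    if "x < y" for x y
    unfolding doubleton_in_class_bases positroid_bases_def
    using that minor_nonzero_iff[of x y] by (auto simp: maximal_minor_eq[OF that])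
  have "J \<in> positroid_bases 2 n D w \<longleftrightarrow> J \<in> class_bases {1..n} label_class" for J
  proof (cases "card J = 2")
    case True
    then obtain x y where "J = {x, y}" "x \<noteq> y" by (auto simp: card_2_iff)
    then show ?thesis using *[of x y] *[of y x] by (metis insert_commute linorder_neqE_nat)
  next
    case False
    then have "J \<notin> class_bases {1..n} label_class"
      by (auto simp: class_bases_def card_2_iff)
    then show ?thesis using False by (simp add: positroid_bases_def)
  qed
  then show ?thesis by blast
qed

text \<open>The two sources form a basis.\<close>

lemma positroid_bases_nonempty: "positroid_bases 2 n D w \<noteq> {}"
proof -
  have "label_class 1 \<noteq> label_class src2"
    using src2_ge_2 p_le_l by (auto simp: label_class_def)
  then have "{1, src2} \<in> class_bases {1..n} label_class"
    using src2_ge_2 n_ge_2 by (simp add: doubleton_in_class_bases)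
  then show ?thesis by (auto simp: positroid_bases_eq)
qed

end

section \<open>The shape of a loopless diagram\<close>

text \<open>Stated for a bare \<open>pre_digraph\<close>, because it is applied before the shape of
  the diagram, and with it the digraph interpretation of the network, is available.\<close>

lemma apath_last_arc:
  assumes "pre_digraph.apath G u q v" "u \<noteq> v"
  obtains e where "e \<in> arcs G" "head G e = v"
proof -
  have "\<exists>e\<in>set q. head G e = v" if "pre_digraph.cas G u q v" "u \<noteq> v" for u
    using that
  proof (induction q arbitrary: u)
    case (Cons a q)
    then show ?case by (cases "head G a = v") (auto simp: pre_digraph.cas.simps)
  qed (simp add: pre_digraph.cas.simps)
  then show ?thesis
    using assms that by (auto simp: pre_digraph.apath_def pre_digraph.awalk_def)
qed

lemma downward_closed_interval:
  fixes S :: "nat set"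
  assumes "S \<subseteq> {1..m}" "\<And>c c'. c \<in> S \<Longrightarrow> 1 \<le> c' \<Longrightarrow> c' \<le> c \<Longrightarrow> c' \<in> S"
  obtains a where "a \<le> m" "S = {1..a}"
proof (cases "S = {}")
  case True
  then show ?thesis using that[of 0] by simp
next
  case False
  have fin: "finite S" using assms(1) by (rule finite_subset) simp
  then have max: "Max S \<in> S" "\<And>c. c \<in> S \<Longrightarrow> c \<le> Max S"
    using False by (auto intro: Max_in)
  then have "S = {1..Max S}" using assms by fastforce
  then show ?thesis using that[of "Max S"] max(1) assms(1) by auto
qed

lemma young_two_rows:
  assumes "young_in_box 2 m Y"
  obtains a b where "b \<le> a" "a \<le> m" "Y = {1} \<times> {1..a} \<union> {2} \<times> {1..b}"
proof -
  have sub: "Y \<subseteq> {1..2} \<times> {1..m}"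
    and down: "\<And>i j i' j'. (i, j) \<in> Y \<Longrightarrow> 1 \<le> i' \<Longrightarrow> i' \<le> i \<Longrightarrow> 1 \<le> j' \<Longrightarrow> j' \<le> j \<Longrightarrow> (i', j') \<in> Y"
    using assms unfolding young_in_box_def by blast+
  have row: "{c. (r, c) \<in> Y} \<subseteq> {1..m}" for r using sub by auto
  have closed: "c' \<in> {c. (r, c) \<in> Y}" if "c \<in> {c. (r, c) \<in> Y}" "1 \<le> c'" "c' \<le> c" for r c c'
    using that sub down[of r c r c'] by auto
  obtain a where a: "a \<le> m" "{c. (1, c) \<in> Y} = {1..a}"
    by (rule downward_closed_interval[OF row[of 1] closed]) (assumption | rule that)+
  obtain b where b: "b \<le> m" "{c. (2, c) \<in> Y} = {1..b}"
    by (rule downward_closed_interval[OF row[of 2] closed]) (assumption | rule that)+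
  have "b \<le> a"
  proof (cases "b = 0")
    case False
    then have "b \<in> {c. (2, c) \<in> Y}" unfolding b(2) by simp
    then have "(2, b) \<in> Y" by simp
    then have "(1, b) \<in> Y" using down[of 2 b 1 b] False by simp
    then have "b \<in> {1..a}" using a(2) by blast
    then show ?thesis by simp
  qed simp
  moreover have "Y = {1} \<times> {1..a} \<union> {2} \<times> {1..b}"
  proof -
    have "(r, c) \<in> Y \<longleftrightarrow> (r, c) \<in> {1} \<times> {1..a} \<union> {2} \<times> {1..b}" for r c
    proof -
      have "(r, c) \<in> Y \<Longrightarrow> r = 1 \<or> r = 2" using sub by auto
      moreover have "(1, c) \<in> Y \<longleftrightarrow> c \<in> {1..a}" "(2, c) \<in> Y \<longleftrightarrow> c \<in> {1..b}"
        using a(2) b(2) by blast+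
      ultimately show ?thesis by auto
    qed
    then show ?thesis by auto
  qed
  ultimately show ?thesis using a(1) that by blast
qed

text \<open>No arc enters the sink of a column without bullets, so its matrix column vanishes and
  with it every minor that uses it; the sink would be a loop.\<close>

lemma loopless_column_nonempty:
  assumes n: "2 \<le> n" and le: "le_diagram 2 (n - 2) D"
    and loopless: "loopless {1..n} (positroid_bases 2 n D w)"
    and c: "1 \<le> c" "c \<le> n - 2"
  shows "\<exists>r. (r, c) \<in> bullets D"
proof (rule ccontr)
  assume empty: "\<nexists>r. (r, c) \<in> bullets D"
  have "young_in_box 2 (n - 2) (boxes D)" using le by (simp add: le_diagram_def)
  then obtain a b where
    ab: "b \<le> a" "a \<le> n - 2" "boxes D = {1} \<times> {1..a} \<union> {2} \<times> {1..b}"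
    by (rule young_two_rows) (rule that)
  have bullets: "bullets D \<subseteq> boxes D" using le by (simp add: le_diagram_def)
  \<comment> \<open>The top row is not yet known to be full, so columns beyond \<open>a\<close>,
    meeting neither row, are a third case.\<close>
  have sink: "sink_label 2 n D c' =
      (n - 2 - c') + (if c' \<le> b then 2 else if c' \<le> a then 1 else 0) + 1" if "1 \<le> c'" for c'
  proof -
    have "{r. (r, c') \<in> boxes D} = (if c' \<le> b then {1, 2} else if c' \<le> a then {1} else {})"
      using that ab(1) unfolding ab(3) by auto
    then show ?thesis by (simp add: sink_label_def)
  qed
  have "{c. (1, c) \<in> boxes D} = {1..a}" "{c. (2, c) \<in> boxes D} = {1..b}"
    unfolding ab(3) by auto
  then have "source_label 2 n D 1 = n - 2 - a + 1" "source_label 2 n D 2 = n - 2 - b + 2"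
    by (simp_all add: source_label_def)
  moreover have "{1..2} = {1, 2::nat}" by auto
  ultimately have src: "sources 2 n D = {n - 2 - a + 1, n - 2 - b + 2}"
    unfolding sources_def by (simp only: image_insert image_empty)
  define j where "j = sink_label 2 n D c"
  have j: "j \<in> {1..n}" "j \<notin> sources 2 n D"
    using c ab n by (auto simp: j_def sink src)
  have no_arc: "head (network 2 n D) e \<noteq> Boundary j" if e: "e \<in> arcs (network 2 n D)" for e
  proof
    assume "head (network 2 n D) e = Boundary j"
    then obtain r c' where rc: "(r, c') \<in> bullets D" "j = sink_label 2 n D c'"
      using e by (auto simp: network_def horizontal_arcs_def vertical_arcs_def)
    then have "1 \<le> c'" "c' \<le> a" using bullets ab by auto
    \<comment> \<open>Sink labels strictly decrease from left to right, so they determine the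
      column.\<close>
    then have "c' = c" using rc(2) c ab by (auto simp: j_def sink split: if_splits)
    then show False using rc(1) empty by blast
  qed
  have zero: "meas 2 n D w i j = 0" if "i \<in> sources 2 n D" for i
  proof -
    have "i \<noteq> j" using that j by blast
    then have "\<not> pre_digraph.apath (network 2 n D) (Boundary i) q (Boundary j)" for q
      using no_arc apath_last_arc[of "network 2 n D" "Boundary i" q "Boundary j"] by blast
    then show ?thesis by (simp add: meas_def)
  qed
  obtain J where J: "J \<in> positroid_bases 2 n D w" "j \<in> J"
    using loopless j(1) unfolding loopless_def by blast
  have "finite J" "card J = 2" "maximal_minor 2 n D w J \<noteq> 0"
    using J(1) by (auto simp: positroid_bases_def intro: card_ge_0_finite)
  have "card (sources 2 n D) = 2"
    unfolding src using ab by auto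
  \<comment> \<open>Two distinct sources make both row indices of the matrix valid list
    positions.\<close>
  then have src_nth: "sorted_list_of_set (sources 2 n D) ! i \<in> sources 2 n D" if "i < 2" for i
    using that by (metis card.infinite length_sorted_list_of_set nth_mem set_sorted_list_of_set zero_neq_numeral)
  obtain b' where b': "b' < 2" "sorted_list_of_set J ! b' = j"
    using J(2) \<open>finite J\<close> \<open>card J = 2\<close>
    by (metis in_set_conv_nth length_sorted_list_of_set set_sorted_list_of_set)
  have "b' = 0 \<or> b' = 1" using b'(1) by auto
  then have "maximal_minor 2 n D w J = 0"
    unfolding maximal_minor_def det_mat_2
    using b'(2) zero[OF src_nth[of 0]] zero[OF src_nth[of 1]] by auto
  then show False using \<open>maximal_minor 2 n D w J \<noteq> 0\<close> by blast
qed

text \<open>Nonempty columns and the Le-condition force the bullets of the bottom row to be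
  right-justified.\<close>

lemma loopless_two_row_diagram:
  assumes n: "2 \<le> n" and le: "le_diagram 2 (n - 2) D"
    and loopless: "loopless {1..n} (positroid_bases 2 n D w)"
  obtains p l where "two_row_diagram n p l D"
proof -
  have "young_in_box 2 (n - 2) (boxes D)" using le by (simp add: le_diagram_def)
  then obtain a b where
    ab: "b \<le> a" "a \<le> n - 2" "boxes D = {1} \<times> {1..a} \<union> {2} \<times> {1..b}"
    by (rule young_two_rows) (rule that)
  have bullets: "bullets D \<subseteq> boxes D"
    and corner: "\<And>j j'. j < j' \<Longrightarrow> (2, j') \<in> boxes D \<Longrightarrow> (1, j') \<in> bullets D \<Longrightarrow>
      (2, j) \<in> bullets D \<Longrightarrow> (2, j') \<in> bullets D"
    using le unfolding le_diagram_def by (blast, metis one_less_numeral_iff semiring_norm(76))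
  note nonempty = loopless_column_nonempty[OF assms]
  have in_rows: "r = 1 \<or> r = 2" "1 \<le> c" "c \<le> a" "r = 2 \<Longrightarrow> c \<le> b" if "(r, c) \<in> bullets D" for r c
    using that bullets ab by auto
  have a: "a = n - 2"
  proof (cases "n - 2 = 0")
    case False
    then have "1 \<le> n - 2" by linarith
    \<comment> \<open>A bullet in the last column of the box forces the top row to reach it.\<close>
    then obtain r where "(r, n - 2) \<in> bullets D" using nonempty[of "n - 2"] by blast
    then show ?thesis using in_rows ab by fastforce
  qed (use ab in simp)
  \<comment> \<open>If the bullet of column \<open>c'\<close> is in the top row, the Le-condition
    with the bottom bullet at \<open>c\<close> to its left fills the bottom box as well.\<close>
  have right_closed: "(2, c') \<in> bullets D" if h: "(2, c) \<in> bullets D" "c \<le> c'" "c' \<le> b" for c c'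
  proof (cases "c = c'")
    case False
    have "1 \<le> c" using h in_rows by blast
    then obtain r where r: "(r, c') \<in> bullets D" using nonempty[of c'] h ab(1,2) by (meson le_trans)
    show ?thesis
      using r in_rows(1)[OF r] corner[of c c'] False h ab \<open>1 \<le> c\<close> by auto
  qed (use h in simp)
  \<comment> \<open>The bullets of the bottom row start just after \<open>p\<close>; for a bottom
    row without bullets this gives \<open>p = b\<close>.\<close>
  define p where "p = (LEAST p. \<forall>c. p < c \<and> c \<le> b \<longrightarrow> (2, c) \<in> bullets D)"
  have p: "\<forall>c. p < c \<and> c \<le> b \<longrightarrow> (2, c) \<in> bullets D"
    unfolding p_def by (rule LeastI[of _ b]) auto
  have least: "p \<le> q" if "\<forall>c. q < c \<and> c \<le> b \<longrightarrow> (2, c) \<in> bullets D" for q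
    unfolding p_def using that by (rule Least_le)
  have gt: "p < c" if "(2, c) \<in> bullets D" for c
  proof -
    have "1 \<le> c" using in_rows that by blast
    moreover have "p \<le> c - 1" using right_closed[OF that] by (intro least) auto
    ultimately show ?thesis by simp
  qed
  have "two_row_diagram n p b D"
  proof
    show "p \<le> b" by (rule least) auto
    show "(2, c) \<in> bullets D \<longleftrightarrow> p < c \<and> c \<le> b" for c
      using gt p in_rows by blast
    show "(1, c) \<in> bullets D" if "1 \<le> c" "c \<le> n - 2" "c \<le> p \<or> b < c" for c
    proof -
      obtain r where r: "(r, c) \<in> bullets D" using nonempty \<open>1 \<le> c\<close> \<open>c \<le> n - 2\<close> by blast
      then have "r \<noteq> 2" using gt[of c] in_rows(4)[of r c] that(3) by auto
      then show ?thesis using in_rows(1)[OF r] r by simp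
    qed
    show "bullets D \<subseteq> {1, 2} \<times> {1..n - 2}" using bullets ab a by auto
  qed (use n ab a in auto)
  then show ?thesis by (rule that)
qed

theorem theorem4p11:
  fixes n :: nat and D :: filled_diagram and w :: "vertex \<times> vertex \<Rightarrow> real"
  assumes "2 \<le> n"
    and "le_diagram 2 (n - 2) D"
    and "network_weights 2 n D w"
    and "loopless {1..n} (positroid_bases 2 n D w)"
  shows "(transversal_matroid {1..n} (positroid_bases 2 n D w) \<longleftrightarrow> tau D \<le> 2) \<and>
    (transversal_matroid {1..n} (positroid_bases 2 n D w) \<longrightarrow>
       (\<exists>Ss. minimal_presentation {1..n} (positroid_bases 2 n D w) Ss \<and> noncrossing n Ss))"
proof -
  obtain p l where "two_row_diagram n p l D"
    using loopless_two_row_diagram[OF assms(1,2,4)] by blast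
  then interpret weighted_two_row_diagram n p l D w
    using assms(3) by (simp add: weighted_two_row_diagram_def weighted_two_row_diagram_axioms_def)
  show ?thesis
    using transversal_cyclic_classes[OF cyclic_label_class] positroid_bases_nonempty
    unfolding positroid_bases_eq tau_eq by blast
qed

end
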